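(* Suppose that (A1), (A2), (A3) and (A5) of the context hold and that $\hat\theta_n^*$ is uniformly tight. Suppose that $\lambda_n\to\infty$ and that, for every compact $\Theta_0\subset\Theta$ and compact $\Gamma_0\subset\Gamma$, $r_n=r_n(\Theta_0,\Gamma_0)\to0$ as $n\to\infty$. Then $\hat\theta_n^*$ is consistent, i.e. $\hat\theta_n^*\to\theta_0^*$ in probability under $P_{\theta_0^*}$.
   Context: Let $T>0$, let $\Theta\subset\mathbb{R}^d$ be open and convex, and let $\Gamma\subset\mathbb{R}\times\mathbb{R}$ be open and convex. Let $F,G:\mathbb{R}\times\mathbb{R}\times[0,T]\times\Theta\to\mathbb{R}$. Write $\theta^*=(\theta,x,z)\in\Theta\times\Gamma$. Consider on $[0,T]$ the initial value problem $$\frac{d\mathbf{x}}{dt}=F(\mathbf{x}(t),\mathbf{z}(t),t,\theta),\quad \frac{d\mathbf{z}}{dt}=G(\mathbf{x}(t),\mathbf{z}(t),t,\theta),\quad \mathbf{x}(0)=x,\ \mathbf{z}(0)=z,$$ whose solution is denoted $(\mathbf{x}(\theta^*,t),\mathbf{z}(\theta^*,t))$. Data: $(Y_1,T_1),(Y_2,T_2),\ldots$ are i.i.d., $Y_i$ real valued, $T_i\in[0,T]$ with distribution $Q$; their joint law is $P_{\theta_0^*}$ (expectation $E_{\theta_0^*}$), where $\theta_0^*\in\Theta\times\Gamma$ is the combination of the true parameter and true initial values. Let $g:\mathbb{R}\times\mathbb{R}\to\mathbb{R}$, $g=g(y,x)$, and for a function $\mathbf{f}$ on $[0,T]$ put $H_n(\mathbf{f})=-\frac1n\sum_{i=1}^n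 g(Y_i,\mathbf{f}(T_i))$. Let $M(\theta^* )=-E_{\theta_0^*}[g(Y_i,\mathbf{x}(\theta^*,T_i))]$. Assumptions: (A1) $Q$ has a density $f$ with respect to Lebesgue measure on $[0,T]$ with $c\le f(t)\le C$ for all $t\in[0,T]$, for two positive numbers $c,C$. (A2) $F,G\in C^3(\mathbb{R}\times\mathbb{R}\times[0,T]\times\Theta)$; for each $\theta\in\Theta$ and $(x,z)\in\Gamma$ the initial value problem has a unique solution on $[0,T]$; and for any $\theta^*\ne\theta^{*\prime}$ in $\Theta\times\Gamma$, $\mathbf{x}(\theta^*,\cdot)\neq\mathbf{x}(\theta^{*\prime},\cdot)$. (A3) On $\Theta\times\Gamma$, $M$ is continuous and has a unique maximum at $\theta_0^*$. (A5) $g$ is nonnegative and belongs to $C^1(\mathbb{R}\times\mathbb{R})$, with $E_{\theta_0^*}\big[\big|\frac{\partial g}{\partial x}(Y_i,\mathbf{x}(\theta_0^*,T_i))\big|\big]<\infty$. If $Y_i$ is not a bounded random variable, then for any compact $\Lambda\subset\mathbb{R}$, $\liminf_{|y|\to\infty}\frac{1+\inf_{x\in\Lambda}g(y,x)}{\sup_{x\in\Lambda}g(y,x)}>0$ and $\liminf_{|y|\to\infty}\frac{1+\inf_{x\in\Lambda}|\frac{\partial g}{\partial x}(y,x)|}{\sup_{x\in\Lambda}|\frac{\partial g}{\partial x}(y,x)|}>0$. Norms: $\|f\|_\infty=\sup_{t\in[0,T]}|f(t)|$; $a\vee b=\max(a,b)$. For $\mathbf{x},\mathbf{z}\in C^1[0,T]$,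 $$J(\mathbf{x},\mathbf{z},\theta)=\int_0^T\Big[\frac{d\mathbf{x}}{dt}-F(\mathbf{x}(t),\mathbf{z}(t),t,\theta)\Big]^2dt+\int_0^T\Big[\frac{d\mathbf{z}}{dt}-G(\mathbf{x}(t),\mathbf{z}(t),t,\theta)\Big]^2dt.$$ Let $\{\mathbb{L}_n\}$ be a sequence of finite-dimensional subspaces of $C^1[0,T]$ and $\lambda_n>0$ smoothing parameters. For $\theta^*=(\theta,x,z)\in\Theta\times\Gamma$, $(\hat{\mathbf{x}}_n(\theta^*,\cdot),\hat{\mathbf{z}}_n(\theta^*,\cdot))$ denotes a maximizer (assumed to exist) of $H_n(\tilde{\mathbf{x}})-\lambda_nJ(\tilde{\mathbf{x}},\tilde{\mathbf{z}},\theta)$ over $\tilde{\mathbf{x}},\tilde{\mathbf{z}}\in\mathbb{L}_n$ with $\tilde{\mathbf{x}}(0)=x$, $\tilde{\mathbf{z}}(0)=z$. The generalized profiling estimator $\hat\theta_n^*$ is a maximizer over $\theta^*\in\Theta\times\Gamma$ of $H_n(\hat{\mathbf{x}}_n(\theta^*,\cdot))$. For compact $\Theta_0\subset\Theta$, $\Gamma_0\subset\Gamma$, $r_n=r_n(\Theta_0,\Gamma_0)$ is the maximum of $$\sup_{\theta^*\in\Theta_0\times\Gamma_0}\inf_{\mathbf{w}\in\mathbb{L}_n,\mathbf{w}(0)=x}\Big[\|\mathbf{x}(\theta^*,\cdot)-\mathbf{w}\|_\infty\vee\Big\|\frac{d\mathbf{x}}{dt}(\theta^*,\cdot)-\frac{d\mathbf{w}}{dt}\Big\|_\infty\Big]$$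 and $$\sup_{\theta^*\in\Theta_0\times\Gamma_0}\inf_{\mathbf{v}\in\mathbb{L}_n,\mathbf{v}(0)=z}\Big[\|\mathbf{z}(\theta^*,\cdot)-\mathbf{v}\|_\infty\vee\Big\|\frac{d\mathbf{z}}{dt}(\theta^*,\cdot)-\frac{d\mathbf{v}}{dt}\Big\|_\infty\Big].$$ A sequence of $\Theta\times\Gamma$-valued estimators $\hat\theta_n^*$ is uniformly tight if for any $\varepsilon>0$ there is a compact set $\Theta_\varepsilon^*\subset\Theta\times\Gamma$ such that $\sup_nP_{\theta_0^*}(\hat\theta_n^*\notin\Theta_\varepsilon^* )<\varepsilon$. *)

theory Defs
  imports "HOL-Probability.Probability" "HOL-Library.Function_Algebras"
begin

text \<open>
  A function on the interval from 0 to \<open>T\<close> is represented by a total function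
  \<open>real \<Rightarrow> real\<close>; no notion below except the span in \<open>fin_dim_C1_subspace\<close> looks at
  values outside the interval, and derivatives at the end points are one-sided.  The
  sample is indexed from 0, so that the first \<open>n\<close> observations are those with index
  below \<open>n\<close>.
\<close>

text \<open>
  \<open>C\<^sup>k\<close> on a set that need not be open: derivatives are taken within \<open>S\<close>, and \<open>D b\<close> is the
  partial derivative in the direction of the basis vector \<open>b\<close>.  For convex \<open>S\<close> with nonempty
  interior, such as the domain of \<open>F\<close> and \<open>G\<close>, the \<open>D b\<close> are unique on \<open>S\<close>.
\<close>

primrec Ck_on :: "nat \<Rightarrow> 'a::euclidean_space set \<Rightarrow> ('a \<Rightarrow> real) \<Rightarrow> bool" where
  "Ck_on 0 S f \<longleftrightarrow> continuous_on S f"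
| "Ck_on (Suc k) S f \<longleftrightarrow>
     (\<exists>D. (\<forall>p\<in>S. (f has_derivative (\<lambda>h. \<Sum>b\<in>Basis. (h \<bullet> b) * D b p)) (at p within S)) \<and>
          (\<forall>b\<in>Basis. Ck_on k S (D b)))"

definition ddt :: "real \<Rightarrow> (real \<Rightarrow> real) \<Rightarrow> real \<Rightarrow> real" where
  "ddt T w t = vector_derivative w (at t within {0..T})"

definition ivp_solution ::
  "real \<Rightarrow> (real \<Rightarrow> real \<Rightarrow> real \<Rightarrow> 'p \<Rightarrow> real) \<Rightarrow> (real \<Rightarrow> real \<Rightarrow> real \<Rightarrow> 'p \<Rightarrow> real) \<Rightarrow>
   'p \<times> real \<times> real \<Rightarrow> (real \<Rightarrow> real) \<Rightarrow> (real \<Rightarrow> real) \<Rightarrow> bool" where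
  "ivp_solution T F G = (\<lambda>(\<theta>, x0, z0) x z.
     x 0 = x0 \<and> z 0 = z0 \<and>
     (\<forall>t\<in>{0..T}. (x has_vector_derivative F (x t) (z t) t \<theta>) (at t within {0..T}) \<and>
                (z has_vector_derivative G (x t) (z t) t \<theta>) (at t within {0..T})))"

definition J ::
  "real \<Rightarrow> (real \<Rightarrow> real \<Rightarrow> real \<Rightarrow> 'p \<Rightarrow> real) \<Rightarrow> (real \<Rightarrow> real \<Rightarrow> real \<Rightarrow> 'p \<Rightarrow> real) \<Rightarrow>
   (real \<Rightarrow> real) \<Rightarrow> (real \<Rightarrow> real) \<Rightarrow> 'p \<Rightarrow> real" where
  "J T F G x z \<theta> =
     integral {0..T} (\<lambda>t. (ddt T x t - F (x t) (z t) t \<theta>)\<^sup>2) +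
     integral {0..T} (\<lambda>t. (ddt T z t - G (x t) (z t) t \<theta>)\<^sup>2)"

definition Hn ::
  "(real \<Rightarrow> real \<Rightarrow> real) \<Rightarrow> (nat \<Rightarrow> 'w \<Rightarrow> real) \<Rightarrow> (nat \<Rightarrow> 'w \<Rightarrow> real) \<Rightarrow>
   nat \<Rightarrow> 'w \<Rightarrow> (real \<Rightarrow> real) \<Rightarrow> real" where
  "Hn g Y \<tau> n \<omega> f = - (1 / real n) * (\<Sum>i<n. g (Y i \<omega>) (f (\<tau> i \<omega>)))"

text \<open>
  Since \<open>g\<close> is nonnegative, the expectation always exists in \<open>[0,\<infinity>]\<close>; the criterion is
  therefore extended real valued, instead of taking the Bochner integral, which is 0 for
  functions that are not integrable.
\<close>

definition Mcrit ::
  "'w measure \<Rightarrow> (real \<Rightarrow> real \<Rightarrow> real) \<Rightarrow> (nat \<Rightarrow> 'w \<Rightarrow> real) \<Rightarrow> (nat \<Rightarrow> 'w \<Rightarrow> real) \<Rightarrow>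
   ('s \<Rightarrow> real \<Rightarrow> real) \<Rightarrow> 's \<Rightarrow> ereal" where
  "Mcrit P g Y \<tau> xs \<theta>s =
     - enn2ereal (\<integral>\<^sup>+\<omega>. ennreal (g (Y 0 \<omega>) (xs \<theta>s (\<tau> 0 \<omega>))) \<partial>P)"

definition iid :: "'w measure \<Rightarrow> (nat \<Rightarrow> 'w \<Rightarrow> real \<times> real) \<Rightarrow> bool" where
  "iid P Z \<longleftrightarrow> prob_space.indep_vars P (\<lambda>_. borel) Z UNIV \<and>
     (\<forall>i. distr P borel (Z i) = distr P borel (Z 0))"

text \<open>
  With values in \<open>ennreal\<close>, the quotient is \<open>\<infinity>\<close> (and not 0) where the supremum vanishes,
  and an empty \<open>\<Lambda>\<close> imposes no condition.
\<close>

definition growth_cond :: "(real \<Rightarrow> real \<Rightarrow> real) \<Rightarrow> real set \<Rightarrow> bool" where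
  "growth_cond h \<Lambda> \<longleftrightarrow>
     Liminf at_infinity (\<lambda>y::real. (1 + (INF x\<in>\<Lambda>. ennreal \<bar>h y x\<bar>)) / (SUP x\<in>\<Lambda>. ennreal \<bar>h y x\<bar>)) > 0"

definition fin_dim_C1_subspace :: "real \<Rightarrow> (real \<Rightarrow> real) set \<Rightarrow> bool" where
  "fin_dim_C1_subspace T L \<longleftrightarrow>
     (\<exists>B. finite B \<and> (\<forall>b\<in>B. Ck_on 1 {0..T} b) \<and> L = module.span (\<lambda>c w t. c * w t) B)"

definition sup_norm :: "real \<Rightarrow> (real \<Rightarrow> real) \<Rightarrow> ennreal" where
  "sup_norm T f = (SUP t\<in>{0..T}. ennreal \<bar>f t\<bar>)"

definition C1_dist :: "real \<Rightarrow> (real \<Rightarrow> real) \<Rightarrow> (real \<Rightarrow> real) \<Rightarrow> ennreal" where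
  "C1_dist T u w = max (sup_norm T (\<lambda>t. u t - w t)) (sup_norm T (\<lambda>t. ddt T u t - ddt T w t))"

definition approx_error ::
  "real \<Rightarrow> (real \<Rightarrow> real) set \<Rightarrow>
   ('p \<times> real \<times> real \<Rightarrow> real \<Rightarrow> real) \<Rightarrow> ('p \<times> real \<times> real \<Rightarrow> real \<Rightarrow> real) \<Rightarrow>
   'p set \<Rightarrow> (real \<times> real) set \<Rightarrow> ennreal" where
  "approx_error T L xs zs \<Theta>0 \<Gamma>0 =
     max (SUP (\<theta>, x, z)\<in>\<Theta>0 \<times> \<Gamma>0. INF w\<in>{w\<in>L. w 0 = x}. C1_dist T (xs (\<theta>, x, z)) w)
         (SUP (\<theta>, x, z)\<in>\<Theta>0 \<times> \<Gamma>0. INF v\<in>{v\<in>L. v 0 = z}. C1_dist T (zs (\<theta>, x, z)) v)"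

definition profile_maximizer ::
  "real \<Rightarrow> (real \<Rightarrow> real \<Rightarrow> real \<Rightarrow> 'p \<Rightarrow> real) \<Rightarrow> (real \<Rightarrow> real \<Rightarrow> real \<Rightarrow> 'p \<Rightarrow> real) \<Rightarrow>
   ((real \<Rightarrow> real) \<Rightarrow> real) \<Rightarrow> real \<Rightarrow> (real \<Rightarrow> real) set \<Rightarrow>
   'p \<times> real \<times> real \<Rightarrow> (real \<Rightarrow> real) \<times> (real \<Rightarrow> real) \<Rightarrow> bool" where
  "profile_maximizer T F G H lam L = (\<lambda>(\<theta>, x, z).
     is_arg_max (\<lambda>(w, v). H w - lam * J T F G w v \<theta>)
                (\<lambda>(w, v). w \<in> L \<and> v \<in> L \<and> w 0 = x \<and> v 0 = z))"

definition uniformly_tight ::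
  "'w measure \<Rightarrow> 's::topological_space set \<Rightarrow> (nat \<Rightarrow> 'w \<Rightarrow> 's) \<Rightarrow> bool" where
  "uniformly_tight P S X \<longleftrightarrow>
     (\<forall>\<epsilon>>0. \<exists>K. compact K \<and> K \<subseteq> S \<and>
        (SUP n\<in>{1..}. measure P {\<omega>\<in>space P. X n \<omega> \<notin> K}) < \<epsilon>)"

definition tendsto_in_prob ::
  "'w measure \<Rightarrow> (nat \<Rightarrow> 'w \<Rightarrow> 's::metric_space) \<Rightarrow> 's \<Rightarrow> bool" where
  "tendsto_in_prob P X c \<longleftrightarrow>
     (\<forall>\<epsilon>>0. (\<lambda>n. measure P {\<omega>\<in>space P. dist (X n \<omega>) c > \<epsilon>}) \<longlonglongrightarrow> 0)"

end

theory Submission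
  imports Defs
begin

text \<open>
  The argument is that of Wald for minimum contrast estimators, with the profiled fits in place of
  the true trajectories.

  First, with probability tending to 1 the fit \<open>xhat n \<omega> p\<close> is uniformly close to the trajectory
  of \<open>p1\<close>, for all \<open>p\<close> near \<open>p1\<close> simultaneously.  Indeed, the sieve contains curves of arbitrarily small penalty \<open>J\<close>
  (\<open>approximants_with_small_penalty\<close>), and since \<open>lam n \<rightarrow> \<infinity>\<close> while the sample loss of bounded curves
  is bounded in probability, the maximizing curve must have small penalty as well.  A Gronwall
  argument (\<open>stability\<close>) turns a small penalty into uniform closeness.  The vector field is Lipschitz
  only locally, so the estimate is closed by continuity in time
  (\<open>gronwall_bootstrap\<close>).  The outcome is \<open>profile_fit_near_trajectory\<close>, a statement about
  an arbitrary functional in place of the sample criterion.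

  Second, let \<open>p1 \<noteq> \<theta>0\<close>.  The sample loss of every curve in a thin tube around the trajectory of \<open>p1\<close>
  is at least a sample mean of a lower envelope of the loss, and the sample loss of every curve in a thin
  tube around the true trajectory is at most a sample mean of an upper envelope.  As the tubes
  shrink, the expectations of the envelopes tend to the expected losses at \<open>p1\<close> and \<open>\<theta>0\<close>, and the
  first is larger, possibly infinite.  By the weak law of large numbers the estimator therefore avoids a
  neighbourhood of \<open>p1\<close> with probability tending to 1 (\<open>wrong_parameter_locally_excluded\<close>).  The growth
  condition enters through the comparison inequality \<open>loss_comparable_AE\<close>, which makes the upper
  envelopes integrable.

  Finally, tightness and a finite covering of a compact set combine the local exclusions
  (\<open>tendsto_in_prob_if_locally_excluded\<close>).
\<close>

section \<open>Regularity of the vector field and of the sieve\<close>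

lemma Ck_on_imp_continuous_on:
  assumes "Ck_on k S f"
  shows "continuous_on S f"
proof (cases k)
  case 0
  then show ?thesis using assms by simp
next
  case (Suc m)
  then show ?thesis
    using assms by (auto simp: continuous_on_eq_continuous_within intro: has_derivative_continuous)
qed

lemma Ck_on_Suc_imp_Ck_on_1:
  assumes "Ck_on (Suc k) S f"
  shows "Ck_on 1 S f"
proof -
  obtain D where
    "\<forall>p\<in>S. (f has_derivative (\<lambda>h. \<Sum>b\<in>Basis. (h \<bullet> b) * D b p)) (at p within S)"
    "\<forall>b\<in>Basis. Ck_on k S (D b)"
    using assms by auto
  then show ?thesis
    unfolding One_nat_def Ck_on.simps using Ck_on_imp_continuous_on
    by (intro exI[of _ D]) blast
qed

text \<open>
  The partial derivatives are continuous, hence bounded on the compact set, and the mean value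
  inequality holds along the segments of the convex set.
\<close>

lemma Ck_on_Suc_lipschitz_on_compact_convex:
  fixes f :: "'a::euclidean_space \<Rightarrow> real"
  assumes f: "Ck_on (Suc k) S f" and C: "compact C" "convex C" "C \<subseteq> S"
  obtains B where "B-lipschitz_on C f"
proof -
  obtain D where D: "\<And>p. p \<in> S \<Longrightarrow>
        (f has_derivative (\<lambda>h. \<Sum>b\<in>Basis. (h \<bullet> b) * D b p)) (at p within S)"
    and Dk: "\<And>b. b \<in> Basis \<Longrightarrow> Ck_on k S (D b)"
    using f by auto
  have "\<exists>M. \<forall>p\<in>C. \<bar>D b p\<bar> \<le> M" if "b \<in> Basis" for b
  proof -
    have "compact (D b ` C)"
      using C Dk[OF that] Ck_on_imp_continuous_on continuous_on_subset
      by (intro compact_continuous_image) blast+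
    then show ?thesis
      using compact_imp_bounded by (fastforce simp: bounded_iff)
  qed
  then obtain M where M: "\<And>b p. b \<in> Basis \<Longrightarrow> p \<in> C \<Longrightarrow> \<bar>D b p\<bar> \<le> M b"
    by metis
  define B where "B = max 0 (\<Sum>b\<in>Basis. M b)"
  have on: "onorm (\<lambda>h. \<Sum>b\<in>Basis. (h \<bullet> b) * D b p) \<le> B" if p: "p \<in> C" for p
  proof (rule onorm_bound)
    fix h :: 'a
    have "\<bar>\<Sum>b\<in>Basis. (h \<bullet> b) * D b p\<bar> \<le> (\<Sum>b\<in>Basis. norm h * M b)"
    proof (intro order_trans[OF sum_abs] sum_mono)
      fix b :: 'a assume b: "b \<in> Basis"
      show "\<bar>(h \<bullet> b) * D b p\<bar> \<le> norm h * M b"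
        unfolding abs_mult using Basis_le_norm[OF b, of h] M[OF b p]
        by (intro mult_mono) auto
    qed
    also have "\<dots> = norm h * (\<Sum>b\<in>Basis. M b)" by (simp add: sum_distrib_left)
    also have "\<dots> \<le> norm h * B" unfolding B_def by (intro mult_left_mono) auto
    finally show "norm (\<Sum>b\<in>Basis. (h \<bullet> b) * D b p) \<le> B * norm h" by (simp add: mult.commute)
  qed (simp add: B_def)
  have "B-lipschitz_on C f"
  proof (rule lipschitz_onI)
    fix p q assume "p \<in> C" "q \<in> C"
    then show "dist (f p) (f q) \<le> B * dist p q"
      unfolding dist_norm
      using C on D has_derivative_subset
      by (intro differentiable_bound[of C f "\<lambda>p h. \<Sum>b\<in>Basis. (h \<bullet> b) * D b p"]) blast+
  qed (simp add: B_def)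
  then show ?thesis by (rule that)
qed

text \<open>
  The derivative is one-sided at the end points, as in \<open>ddt\<close>, so that the solutions of the initial
  value problem and the elements of the sieve fall under the same notion.
\<close>

definition C1 :: "real \<Rightarrow> (real \<Rightarrow> real) \<Rightarrow> bool" where
  "C1 T w \<longleftrightarrow> (\<exists>w'. continuous_on {0..T} w' \<and>
     (\<forall>t\<in>{0..T}. (w has_vector_derivative w' t) (at t within {0..T})))"

lemma ddt_eqI:
  assumes "T > 0" "t \<in> {0..T}" "(w has_vector_derivative d) (at t within {0..T})"
  shows "ddt T w t = d"
  unfolding ddt_def using assms
  by (intro vector_derivative_within_closed_interval) auto

lemma C1D:
  assumes "T > 0" "C1 T w"
  shows "continuous_on {0..T} (ddt T w)"
    and "\<And>t. t \<in> {0..T} \<Longrightarrow> (w has_vector_derivative ddt T w t) (at t within {0..T})"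
proof -
  obtain w' where w': "continuous_on {0..T} w'"
    "\<And>t. t \<in> {0..T} \<Longrightarrow> (w has_vector_derivative w' t) (at t within {0..T})"
    using assms(2) unfolding C1_def by blast
  then have eq: "ddt T w t = w' t" if "t \<in> {0..T}" for t
    using ddt_eqI assms(1) that by blast
  show "continuous_on {0..T} (ddt T w)"
    using w'(1) eq continuous_on_cong[OF refl, of "{0..T}" "ddt T w" w'] by blast
  show "(w has_vector_derivative ddt T w t) (at t within {0..T})" if "t \<in> {0..T}" for t
    using w'(2) eq that by simp
qed

lemma C1_imp_continuous_on: "C1 T w \<Longrightarrow> continuous_on {0..T} w"
  unfolding C1_def continuous_on_eq_continuous_within
  using has_vector_derivative_continuous by blast

lemma fin_dim_C1_subspace_imp_C1:
  assumes "fin_dim_C1_subspace T L" "w \<in> L"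
  shows "C1 T w"
proof -
  interpret module "\<lambda>(c::real) (w::real \<Rightarrow> real) t. c * w t"
    by unfold_locales (auto simp: fun_eq_iff algebra_simps)
  obtain B where B: "\<And>b. b \<in> B \<Longrightarrow> Ck_on 1 {0..T} b" "L = span B"
    using assms(1) unfolding fin_dim_C1_subspace_def by blast
  have "C1 T b" if b: "b \<in> B" for b
    using B(1)[OF b] unfolding C1_def
    by (auto simp: has_vector_derivative_def mult.commute)
  moreover have "subspace {w. C1 T w}"
    unfolding subspace_def
  proof (intro conjI allI impI ballI; simp)
    show "C1 T 0"
      unfolding C1_def zero_fun_def by (intro exI[of _ "\<lambda>_. 0"]) (auto intro!: derivative_eq_intros)
  next
    fix u v assume "C1 T u" "C1 T v"
    then obtain u' v' where
      "continuous_on {0..T} u'" "continuous_on {0..T} v'"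
      "\<And>t. t \<in> {0..T} \<Longrightarrow> (u has_vector_derivative u' t) (at t within {0..T})"
      "\<And>t. t \<in> {0..T} \<Longrightarrow> (v has_vector_derivative v' t) (at t within {0..T})"
      unfolding C1_def by blast
    then show "C1 T (u + v)"
      unfolding C1_def plus_fun_def
      by (intro exI[of _ "\<lambda>t. u' t + v' t"]) (auto intro!: continuous_intros has_vector_derivative_add)
  next
    fix c :: real and u assume "C1 T u"
    then obtain u' where "continuous_on {0..T} u'"
      "\<And>t. t \<in> {0..T} \<Longrightarrow> (u has_vector_derivative u' t) (at t within {0..T})"
      unfolding C1_def by blast
    then show "C1 T (\<lambda>t. c * u t)"
      unfolding C1_def
      by (intro exI[of _ "\<lambda>t. c * u' t"]) (auto intro!: continuous_intros has_vector_derivative_mult_right)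
  qed
  ultimately have "span B \<subseteq> {w. C1 T w}"
    by (intro span_minimal) auto
  then show ?thesis using assms(2) B(2) by auto
qed

section \<open>A Gronwall estimate that is only assumed near zero\<close>

text \<open>
  The differential inequality is available only where \<open>e \<le> 1\<close>, because a \<open>C\<^sup>1\<close> vector field is
  Lipschitz only locally.  As long as \<open>e\<close> has not exceeded 1, the usual argument (monotonicity of
  \<open>exp (- K t) e t - \<integral> \<zeta>\<close>) gives a bound that is strictly below 1; hence \<open>e\<close> cannot reach 1 at any
  first time, and the bound holds on the whole interval.
\<close>

lemma gronwall_bootstrap:
  fixes e e' \<zeta> :: "real \<Rightarrow> real"
  assumes T: "T > 0" and K: "K \<ge> 0"
    and e: "\<And>t. t \<in> {0..T} \<Longrightarrow> (e has_vector_derivative e' t) (at t within {0..T})"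
    and e0: "e 0 \<ge> 0"
    and \<zeta>: "continuous_on {0..T} \<zeta>" "\<And>t. t \<in> {0..T} \<Longrightarrow> \<zeta> t \<ge> 0"
    and ineq: "\<And>t. t \<in> {0..T} \<Longrightarrow> e t \<le> 1 \<Longrightarrow> e' t \<le> K * e t + \<zeta> t"
    and \<delta>: "e 0 + integral {0..T} \<zeta> \<le> \<delta>" and small: "exp (K * T) * \<delta> < 1"
    and t: "t \<in> {0..T}"
  shows "e t \<le> exp (K * T) * \<delta>"
proof -
  have \<delta>0: "\<delta> \<ge> 0"
    using \<delta> e0 integral_nonneg[of \<zeta> "{0..T}"] \<zeta> integrable_continuous_interval[of 0 T \<zeta>] by auto
  have *: "e s \<le> exp (K * T) * \<delta>" if s: "s \<in> {0..T}" and le1: "\<And>r. r \<in> {0..s} \<Longrightarrow> e r \<le> 1" for s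
  proof -
    define h where "h t = exp (- K * t) * e t" for t
    define h' where "h' t = exp (- K * t) * (e' t - K * e t)" for t
    have sub: "{0..s} \<subseteq> {0..T}" using s by auto
    have dh: "(h has_vector_derivative h' r) (at r within {0..s})" if r: "r \<in> {0..s}" for r
    proof -
      have "(e has_real_derivative e' r) (at r within {0..s})"
        using has_vector_derivative_within_subset[OF e sub] r sub
        by (auto simp: has_real_derivative_iff_has_vector_derivative)
      then have "(h has_real_derivative h' r) (at r within {0..s})"
        unfolding h_def h'_def by (auto intro!: derivative_eq_intros simp: algebra_simps)
      then show ?thesis by (simp add: has_real_derivative_iff_has_vector_derivative)
    qed
    have hi: "(h' has_integral h s - h 0) {0..s}"
      using s dh by (intro fundamental_theorem_of_calculus) auto
    have \<zeta>i: "\<zeta> integrable_on {0..s}" "\<zeta> integrable_on {0..T}"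
      using continuous_on_subset[OF \<zeta>(1) sub] \<zeta>(1) by (auto intro: integrable_continuous_interval)
    have "h s - h 0 \<le> integral {0..s} \<zeta>"
    proof (rule has_integral_le[OF hi integrable_integral[OF \<zeta>i(1)]])
      fix r assume r: "r \<in> {0..s}"
      then have rT: "r \<in> {0..T}" using sub by auto
      have "h' r \<le> exp (- K * r) * \<zeta> r"
        unfolding h'_def using ineq[OF rT le1[OF r]] by (intro mult_left_mono) auto
      also have "\<dots> \<le> 1 * \<zeta> r"
        using K r \<zeta>(2)[OF rT] by (intro mult_right_mono) auto
      finally show "h' r \<le> \<zeta> r" by simp
    qed
    also have "\<dots> \<le> integral {0..T} \<zeta>"
      using \<zeta>i \<zeta>(2) sub by (intro integral_subset_le) auto
    finally have "h s \<le> \<delta>" using \<delta> by (simp add: h_def)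
    then have "exp (K * s) * h s \<le> exp (K * s) * \<delta>" by (intro mult_left_mono) auto
    also have "\<dots> \<le> exp (K * T) * \<delta>"
      using s K \<delta>0 by (intro mult_right_mono) (auto intro: mult_left_mono)
    also have "exp (K * s) * h s = e s" by (simp add: h_def exp_minus)
    finally show ?thesis .
  qed
  have cont: "continuous_on {0..T} e"
    unfolding continuous_on_eq_continuous_within using e has_vector_derivative_continuous by blast
  have "e r < 1" if r: "r \<in> {0..T}" for r
  proof (rule ccontr)
    assume "\<not> e r < 1"
    have e01: "e 0 < 1"
    proof -
      have "e 0 \<le> \<delta>"
        using \<delta> integral_nonneg[of \<zeta> "{0..T}"] \<zeta> integrable_continuous_interval[of 0 T \<zeta>] by auto
      also have "\<dots> \<le> exp (K * T) * \<delta>"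
        using \<delta>0 K T mult_right_mono[of 1 "exp (K*T)" \<delta>] by auto
      finally show ?thesis using small by simp
    qed
    have ivt: "\<exists>q. 0 \<le> q \<and> q \<le> p \<and> e q = 1" if p: "p \<in> {0..T}" "e p \<ge> 1" for p
    proof -
      have "{0..p} \<subseteq> {0..T}" using p by auto
      from continuous_on_subset[OF cont this] show ?thesis
        using p e01 by (intro IVT') auto
    qed
    \<comment> \<open>The minimum of this set is the first time at which the level 1 is reached.\<close>
    define Z where "Z = {q \<in> {0..T}. e q = 1}"
    have "Z \<noteq> {}" using ivt[OF r] \<open>\<not> e r < 1\<close> r unfolding Z_def by force
    moreover have "compact Z"
    proof -
      have "closed Z"
        using continuous_closed_preimage[OF cont, of "{1}"] by (simp add: Z_def vimage_def Int_def)
      moreover have "bounded Z" by (rule bounded_subset[of "{0..T}"]) (auto simp: Z_def)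
      ultimately show ?thesis by (simp add: compact_eq_bounded_closed)
    qed
    ultimately obtain s where s: "s \<in> Z" "\<And>q. q \<in> Z \<Longrightarrow> s \<le> q"
      using compact_attains_inf[of Z] by auto
    have "e q \<le> 1" if q: "q \<in> {0..s}" for q
    proof (rule ccontr)
      assume "\<not> e q \<le> 1"
      then obtain p where p: "0 \<le> p" "p \<le> q" "e p = 1"
        using ivt[of q] q s(1) by (auto simp: Z_def)
      then have "p \<in> Z" using q s(1) by (auto simp: Z_def)
      then have "p = q" using s(2) p q by force
      then show False using p \<open>\<not> e q \<le> 1\<close> by simp
    qed
    then have "e s \<le> exp (K * T) * \<delta>" using s(1) by (intro *) (auto simp: Z_def)
    then show False using small s(1) by (simp add: Z_def)
  qed
  then show ?thesis using t by (intro *) (auto intro: less_imp_le)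
qed

section \<open>Stability of the initial value problem\<close>

locale parametric_ivp =
  fixes T :: real
    and \<Theta> :: "'p::euclidean_space set" and \<Gamma> :: "(real \<times> real) set"
    and F G :: "real \<Rightarrow> real \<Rightarrow> real \<Rightarrow> 'p \<Rightarrow> real"
    and xs zs :: "'p \<times> real \<times> real \<Rightarrow> real \<Rightarrow> real"
  assumes T_pos: "T > 0"
    and open_Theta: "open \<Theta>" and open_Gamma: "open \<Gamma>"
    and F_C1: "Ck_on 1 (UNIV \<times> UNIV \<times> {0..T} \<times> \<Theta>) (\<lambda>(x, z, t, \<theta>). F x z t \<theta>)"
    and G_C1: "Ck_on 1 (UNIV \<times> UNIV \<times> {0..T} \<times> \<Theta>) (\<lambda>(x, z, t, \<theta>). G x z t \<theta>)"
    and solution: "\<And>p. p \<in> \<Theta> \<times> \<Gamma> \<Longrightarrow> ivp_solution T F G p (xs p) (zs p)"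
begin

text \<open>
  The squared form is the one that enters the energy estimate below.
\<close>

lemma lipschitz_on_box:
  assumes V: "Ck_on 1 (UNIV \<times> UNIV \<times> {0..T} \<times> \<Theta>) (\<lambda>(x, z, t, \<theta>). V x z t \<theta>)"
    and \<rho>: "cball \<theta>1 \<rho> \<subseteq> \<Theta>"
  shows "\<exists>B\<ge>0. \<forall>x\<in>{-R..R}. \<forall>z\<in>{-R..R}. \<forall>x'\<in>{-R..R}. \<forall>z'\<in>{-R..R}.
           \<forall>t\<in>{0..T}. \<forall>\<theta>\<in>cball \<theta>1 \<rho>. \<forall>\<theta>'\<in>cball \<theta>1 \<rho>.
             (V x z t \<theta> - V x' z' t \<theta>')\<^sup>2 \<le> B * ((x - x')\<^sup>2 + (z - z')\<^sup>2 + (dist \<theta> \<theta>')\<^sup>2)"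
proof -
  define C where "C = {-R..R} \<times> {-R..R} \<times> {0..T} \<times> cball \<theta>1 \<rho>"
  have C: "compact C" "convex C" "C \<subseteq> UNIV \<times> UNIV \<times> {0..T} \<times> \<Theta>"
    unfolding C_def using \<rho> by (auto intro!: compact_Times convex_Times)
  obtain B where B: "B-lipschitz_on C (\<lambda>(x, z, t, \<theta>). V x z t \<theta>)"
    by (rule Ck_on_Suc_lipschitz_on_compact_convex[OF V[unfolded One_nat_def] C])
  show ?thesis
  proof (intro exI[of _ "B\<^sup>2"] conjI ballI)
    fix x z x' z' t \<theta> \<theta>'
    assume "x \<in> {-R..R}" "z \<in> {-R..R}" "x' \<in> {-R..R}" "z' \<in> {-R..R}" "t \<in> {0..T}"
      "\<theta> \<in> cball \<theta>1 \<rho>" "\<theta>' \<in> cball \<theta>1 \<rho>"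
    then have "(x, z, t, \<theta>) \<in> C" "(x', z', t, \<theta>') \<in> C" by (auto simp: C_def)
    from lipschitz_onD[OF B this]
    have "\<bar>V x z t \<theta> - V x' z' t \<theta>'\<bar> \<le> B * dist (x, z, t, \<theta>) (x', z', t, \<theta>')"
      by (simp add: dist_real_def)
    then have "\<bar>V x z t \<theta> - V x' z' t \<theta>'\<bar>\<^sup>2 \<le> (B * dist (x, z, t, \<theta>) (x', z', t, \<theta>'))\<^sup>2"
      by (intro power_mono) auto
    then show "(V x z t \<theta> - V x' z' t \<theta>')\<^sup>2 \<le> B\<^sup>2 * ((x - x')\<^sup>2 + (z - z')\<^sup>2 + (dist \<theta> \<theta>')\<^sup>2)"
      by (simp add: power_mult_distrib dist_Pair_Pair dist_real_def add.assoc)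
  qed simp
qed

lemma continuous_on_along:
  assumes V: "Ck_on 1 (UNIV \<times> UNIV \<times> {0..T} \<times> \<Theta>) (\<lambda>(x, z, t, \<theta>). V x z t \<theta>)"
    and "continuous_on {0..T} w" "continuous_on {0..T} v" "\<theta> \<in> \<Theta>"
  shows "continuous_on {0..T} (\<lambda>t. V (w t) (v t) t \<theta>)"
proof -
  have "continuous_on {0..T} ((\<lambda>(x, z, t, \<theta>). V x z t \<theta>) \<circ> (\<lambda>t. (w t, v t, t, \<theta>)))"
    using assms
    by (intro continuous_on_compose continuous_on_subset[OF Ck_on_imp_continuous_on[OF V]]
        continuous_intros) auto
  then show ?thesis by (simp add: comp_def)
qed

lemma solution_simps:
  assumes "(\<theta>, a, b) \<in> \<Theta> \<times> \<Gamma>"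
  shows "xs (\<theta>, a, b) 0 = a" "zs (\<theta>, a, b) 0 = b"
    and "\<And>t. t \<in> {0..T} \<Longrightarrow> (xs (\<theta>, a, b) has_vector_derivative
           F (xs (\<theta>, a, b) t) (zs (\<theta>, a, b) t) t \<theta>) (at t within {0..T})"
    and "\<And>t. t \<in> {0..T} \<Longrightarrow> (zs (\<theta>, a, b) has_vector_derivative
           G (xs (\<theta>, a, b) t) (zs (\<theta>, a, b) t) t \<theta>) (at t within {0..T})"
  using solution[OF assms] by (auto simp: ivp_solution_def)

lemma continuous_on_solution:
  assumes "p \<in> \<Theta> \<times> \<Gamma>"
  shows "continuous_on {0..T} (xs p)" "continuous_on {0..T} (zs p)"
proof -
  obtain \<theta> a b where p: "p = (\<theta>, a, b)" by (cases p)
  then show "continuous_on {0..T} (xs p)" "continuous_on {0..T} (zs p)"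
    unfolding continuous_on_eq_continuous_within
    using solution_simps(3,4)[of \<theta> a b, THEN has_vector_derivative_continuous] assms by auto
qed

lemma ddt_solution:
  assumes "(\<theta>, a, b) \<in> \<Theta> \<times> \<Gamma>" "t \<in> {0..T}"
  shows "ddt T (xs (\<theta>, a, b)) t = F (xs (\<theta>, a, b) t) (zs (\<theta>, a, b) t) t \<theta>"
    and "ddt T (zs (\<theta>, a, b)) t = G (xs (\<theta>, a, b) t) (zs (\<theta>, a, b) t) t \<theta>"
  by (rule ddt_eqI[OF T_pos assms(2) solution_simps(3)[OF assms]]
           ddt_eqI[OF T_pos assms(2) solution_simps(4)[OF assms]])+

lemma C1_solution:
  assumes "(\<theta>, a, b) \<in> \<Theta> \<times> \<Gamma>"
  shows "C1 T (xs (\<theta>, a, b))" "C1 T (zs (\<theta>, a, b))"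
  unfolding C1_def
  using solution_simps(3,4)[OF assms] assms
    continuous_on_along[OF F_C1 continuous_on_solution[OF assms], of \<theta>]
    continuous_on_along[OF G_C1 continuous_on_solution[OF assms], of \<theta>] by auto

lemma J_solution:
  assumes "(\<theta>, a, b) \<in> \<Theta> \<times> \<Gamma>"
  shows "J T F G (xs (\<theta>, a, b)) (zs (\<theta>, a, b)) \<theta> = 0"
proof -
  have "integral {0..T} (\<lambda>t. (ddt T (xs (\<theta>, a, b)) t - F (xs (\<theta>, a, b) t) (zs (\<theta>, a, b) t) t \<theta>)\<^sup>2) = 0"
    "integral {0..T} (\<lambda>t. (ddt T (zs (\<theta>, a, b)) t - G (xs (\<theta>, a, b) t) (zs (\<theta>, a, b) t) t \<theta>)\<^sup>2) = 0"
    by (subst integral_cong[of "{0..T}" _ "\<lambda>_. 0"]; simp add: ddt_solution[OF assms])+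
  then show ?thesis by (simp add: J_def)
qed

lemma bounded_solution:
  assumes "p \<in> \<Theta> \<times> \<Gamma>"
  obtains R where "R \<ge> 0" "\<And>t. t \<in> {0..T} \<Longrightarrow> \<bar>xs p t\<bar> \<le> R" "\<And>t. t \<in> {0..T} \<Longrightarrow> \<bar>zs p t\<bar> \<le> R"
proof -
  have "bounded (xs p ` {0..T} \<union> zs p ` {0..T})"
    using continuous_on_solution[OF assms]
    by (intro bounded_Un[THEN iffD2] conjI compact_imp_bounded compact_continuous_image) auto
  then obtain R where "R > 0" "\<And>x. x \<in> xs p ` {0..T} \<union> zs p ` {0..T} \<Longrightarrow> norm x \<le> R"
    using bounded_pos by metis
  then show ?thesis by (intro that[of R]) auto
qed

text \<open>
  A pair of curves that starts near the initial values of \<open>p1\<close> and almost solves the equation of a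
  nearby parameter, in the mean square sense measured by \<open>J\<close>, stays uniformly close to the
  trajectory of \<open>p1\<close>.  The energy \<open>e = (w - x1)\<^sup>2 + (v - z1)\<^sup>2\<close> satisfies
  \<open>e' \<le> K e + (squared defects) + const * dist \<theta> \<theta>1 ^ 2\<close> while the curves remain in a box around
  the trajectory, that is, while \<open>e \<le> 1\<close>; squares of the defects appear because products
  \<open>2 u c\<close> are split into \<open>u\<^sup>2 + c\<^sup>2\<close>, so \<open>J\<close> bounds their integral directly.  Applied to exact
  solutions, where \<open>J = 0\<close>, this is continuous dependence on parameter and initial values.
\<close>

lemma stability:
  assumes p1: "p1 \<in> \<Theta> \<times> \<Gamma>" and \<eta>: "\<eta> > 0"
  obtains \<delta> where "\<delta> > 0"
    "\<And>\<theta> a b w v t. (\<theta>, a, b) \<in> \<Theta> \<times> \<Gamma> \<Longrightarrow> dist (\<theta>, a, b) p1 < \<delta> \<Longrightarrow> C1 T w \<Longrightarrow> C1 T v \<Longrightarrow>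
       w 0 = a \<Longrightarrow> v 0 = b \<Longrightarrow> J T F G w v \<theta> \<le> \<delta> \<Longrightarrow> t \<in> {0..T} \<Longrightarrow>
       \<bar>w t - xs p1 t\<bar> \<le> \<eta> \<and> \<bar>v t - zs p1 t\<bar> \<le> \<eta>"
proof -
  obtain \<theta>1 a1 b1 where p1_eq: "p1 = (\<theta>1, a1, b1)" by (cases p1)
  have \<theta>1: "\<theta>1 \<in> \<Theta>" and p1': "(\<theta>1, a1, b1) \<in> \<Theta> \<times> \<Gamma>" using p1 p1_eq by auto
  obtain R where R: "R \<ge> 0" "\<And>t. t \<in> {0..T} \<Longrightarrow> \<bar>xs p1 t\<bar> \<le> R" "\<And>t. t \<in> {0..T} \<Longrightarrow> \<bar>zs p1 t\<bar> \<le> R"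
    using bounded_solution[OF p1] by blast
  obtain \<rho> where \<rho>: "\<rho> > 0" "cball \<theta>1 \<rho> \<subseteq> \<Theta>"
    using open_Theta \<theta>1 open_contains_cball by blast
  obtain BF where BF: "BF \<ge> 0" "\<forall>x\<in>{-(R+1)..R+1}. \<forall>z\<in>{-(R+1)..R+1}.
      \<forall>x'\<in>{-(R+1)..R+1}. \<forall>z'\<in>{-(R+1)..R+1}.
      \<forall>t\<in>{0..T}. \<forall>\<theta>\<in>cball \<theta>1 \<rho>. \<forall>\<theta>'\<in>cball \<theta>1 \<rho>.
       (F x z t \<theta> - F x' z' t \<theta>')\<^sup>2 \<le> BF * ((x - x')\<^sup>2 + (z - z')\<^sup>2 + (dist \<theta> \<theta>')\<^sup>2)"
    using lipschitz_on_box[OF F_C1 \<rho>(2), of "R + 1"] by blast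
  obtain BG where BG: "BG \<ge> 0" "\<forall>x\<in>{-(R+1)..R+1}. \<forall>z\<in>{-(R+1)..R+1}.
      \<forall>x'\<in>{-(R+1)..R+1}. \<forall>z'\<in>{-(R+1)..R+1}.
      \<forall>t\<in>{0..T}. \<forall>\<theta>\<in>cball \<theta>1 \<rho>. \<forall>\<theta>'\<in>cball \<theta>1 \<rho>.
       (G x z t \<theta> - G x' z' t \<theta>')\<^sup>2 \<le> BG * ((x - x')\<^sup>2 + (z - z')\<^sup>2 + (dist \<theta> \<theta>')\<^sup>2)"
    using lipschitz_on_box[OF G_C1 \<rho>(2), of "R + 1"] by blast
  define B where "B = BF + BG"
  define K where "K = 2 + B"
  \<comment> \<open>The bound \<open>exp (K * T) * \<epsilon>\<close> of the Gronwall estimate must be below 1 and at most the square of the tolerance.\<close>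
  define \<epsilon> where "\<epsilon> = exp (- (K * T)) * min (1/2) (\<eta>\<^sup>2)"
  define \<delta> where "\<delta> = min (min 1 \<rho>) (\<epsilon> / (2 + B * T))"
  have B0: "B \<ge> 0" and K0: "K \<ge> 0" using BF(1) BG(1) by (auto simp: B_def K_def)
  have exp\<epsilon>: "exp (K * T) * \<epsilon> = min (1/2) (\<eta>\<^sup>2)" by (simp add: \<epsilon>_def exp_minus)
  have \<epsilon>0: "\<epsilon> > 0" using \<eta> by (simp add: \<epsilon>_def)
  have BT: "B * T \<ge> 0" using B0 T_pos by simp
  show ?thesis
  proof (rule that[of \<delta>])
    show "\<delta> > 0" using \<epsilon>0 \<rho>(1) BT by (simp add: \<delta>_def add_pos_nonneg)
    fix \<theta> a b w v t
    assume p: "(\<theta>, a, b) \<in> \<Theta> \<times> \<Gamma>" and d: "dist (\<theta>, a, b) p1 < \<delta>"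
      and w: "C1 T w" and v: "C1 T v" and w0: "w 0 = a" and v0: "v 0 = b"
      and J: "J T F G w v \<theta> \<le> \<delta>" and t: "t \<in> {0..T}"
    define \<alpha> where "\<alpha> t = w t - xs p1 t" for t
    define \<beta> where "\<beta> t = v t - zs p1 t" for t
    define P where "P t = ddt T w t - F (w t) (v t) t \<theta>" for t
    define Q where "Q t = ddt T v t - G (w t) (v t) t \<theta>" for t
    define e where "e t = (\<alpha> t)\<^sup>2 + (\<beta> t)\<^sup>2" for t
    define e' where "e' t = 2 * \<alpha> t * (ddt T w t - F (xs p1 t) (zs p1 t) t \<theta>1) +
                            2 * \<beta> t * (ddt T v t - G (xs p1 t) (zs p1 t) t \<theta>1)" for t
    define r where "r = dist \<theta> \<theta>1"
    define \<zeta> where "\<zeta> t = (P t)\<^sup>2 + (Q t)\<^sup>2 + B * r\<^sup>2" for t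
    have "(dist (\<theta>, a, b) p1)\<^sup>2 = r\<^sup>2 + (a - a1)\<^sup>2 + (b - b1)\<^sup>2"
      unfolding p1_eq r_def by (simp add: dist_Pair_Pair dist_real_def)
    moreover have "(dist (\<theta>, a, b) p1)\<^sup>2 \<le> \<delta>\<^sup>2" using d by (intro power_mono) auto
    moreover have "\<delta>\<^sup>2 \<le> \<delta>"
      using \<open>\<delta> > 0\<close> mult_left_mono[of \<delta> 1 \<delta>] by (simp add: \<delta>_def power2_eq_square)
    ultimately have sq: "r\<^sup>2 + (a - a1)\<^sup>2 + (b - b1)\<^sup>2 \<le> \<delta>" by simp
    have r\<rho>: "r \<le> \<rho>"
    proof -
      have "r \<le> dist (\<theta>, a, b) p1" unfolding r_def p1_eq dist_Pair_Pair by (rule real_le_rsqrt) simp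
      then show ?thesis using d by (simp add: \<delta>_def)
    qed
    have \<theta>: "\<theta> \<in> \<Theta>" "\<theta> \<in> cball \<theta>1 \<rho>" "\<theta>1 \<in> cball \<theta>1 \<rho>"
      using p r\<rho> \<rho>(1) by (auto simp: r_def dist_commute)
    have contP: "continuous_on {0..T} P"
      unfolding P_def using C1D(1)[OF T_pos w] continuous_on_along[OF F_C1 _ _ \<theta>(1)] w v
      by (intro continuous_intros) (auto intro: C1_imp_continuous_on)
    have contQ: "continuous_on {0..T} Q"
      unfolding Q_def using C1D(1)[OF T_pos v] continuous_on_along[OF G_C1 _ _ \<theta>(1)] w v
      by (intro continuous_intros) (auto intro: C1_imp_continuous_on)
    have "e t \<le> exp (K * T) * \<epsilon>"
    proof (rule gronwall_bootstrap[OF T_pos K0, of e e' \<zeta>])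
      fix s assume s: "s \<in> {0..T}"
      have "(w has_real_derivative ddt T w s) (at s within {0..T})"
        "(v has_real_derivative ddt T v s) (at s within {0..T})"
        "(xs p1 has_real_derivative F (xs p1 s) (zs p1 s) s \<theta>1) (at s within {0..T})"
        "(zs p1 has_real_derivative G (xs p1 s) (zs p1 s) s \<theta>1) (at s within {0..T})"
        using C1D(2)[OF T_pos w s] C1D(2)[OF T_pos v s] solution_simps(3,4)[OF p1' s]
        by (auto simp: has_real_derivative_iff_has_vector_derivative p1_eq)
      then have "(e has_real_derivative e' s) (at s within {0..T})"
        unfolding e_def \<alpha>_def \<beta>_def e'_def
        by (auto intro!: derivative_eq_intros simp: algebra_simps)
      then show "(e has_vector_derivative e' s) (at s within {0..T})"
        by (simp add: has_real_derivative_iff_has_vector_derivative)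
    next
      show "e 0 \<ge> 0" by (simp add: e_def)
      show "continuous_on {0..T} \<zeta>"
        unfolding \<zeta>_def by (intro continuous_intros contP contQ)
      show "\<zeta> s \<ge> 0" for s using B0 by (simp add: \<zeta>_def)
    next
      fix s assume s: "s \<in> {0..T}" and es: "e s \<le> 1"
      have "(\<alpha> s)\<^sup>2 \<le> 1" "(\<beta> s)\<^sup>2 \<le> 1"
        using es zero_le_power2[of "\<alpha> s"] zero_le_power2[of "\<beta> s"] unfolding e_def by linarith+
      then have ab1: "\<bar>\<alpha> s\<bar> \<le> 1" "\<bar>\<beta> s\<bar> \<le> 1" by (auto simp: abs_square_le_1)
      have box: "w s \<in> {-(R+1)..R+1}" "v s \<in> {-(R+1)..R+1}" "xs p1 s \<in> {-(R+1)..R+1}"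
        "zs p1 s \<in> {-(R+1)..R+1}"
        using ab1 R(2)[OF s] R(3)[OF s] unfolding \<alpha>_def \<beta>_def by auto
      define \<Delta>F where "\<Delta>F = F (w s) (v s) s \<theta> - F (xs p1 s) (zs p1 s) s \<theta>1"
      define \<Delta>G where "\<Delta>G = G (w s) (v s) s \<theta> - G (xs p1 s) (zs p1 s) s \<theta>1"
      have dF: "\<Delta>F\<^sup>2 \<le> BF * (e s + r\<^sup>2)" and dG: "\<Delta>G\<^sup>2 \<le> BG * (e s + r\<^sup>2)"
        using BF(2)[rule_format, OF box s \<theta>(2,3)] BG(2)[rule_format, OF box s \<theta>(2,3)]
        by (simp_all add: \<Delta>F_def \<Delta>G_def e_def \<alpha>_def \<beta>_def r_def)
      have young: "2 * u * (c + k) \<le> 2 * u\<^sup>2 + c\<^sup>2 + k\<^sup>2" for u c k :: real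
        using zero_le_power2[of "u - c"] zero_le_power2[of "u - k"]
        by (simp add: power2_eq_square algebra_simps)
      have "e' s = 2 * \<alpha> s * (P s + \<Delta>F) + 2 * \<beta> s * (Q s + \<Delta>G)"
        by (simp add: e'_def P_def Q_def \<Delta>F_def \<Delta>G_def)
      also have "\<dots> \<le> 2 * e s + (P s)\<^sup>2 + (Q s)\<^sup>2 + \<Delta>F\<^sup>2 + \<Delta>G\<^sup>2"
        using young[of "\<alpha> s" "P s" \<Delta>F] young[of "\<beta> s" "Q s" \<Delta>G] by (simp add: e_def)
      also have "\<dots> \<le> K * e s + \<zeta> s"
        using dF dG by (simp add: K_def \<zeta>_def B_def algebra_simps)
      finally show "e' s \<le> K * e s + \<zeta> s" .
    next
      have "integral {0..T} \<zeta> = J T F G w v \<theta> + B * r\<^sup>2 * T"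
      proof -
        have "(\<lambda>t. (P t)\<^sup>2) integrable_on {0..T}" "(\<lambda>t. (Q t)\<^sup>2) integrable_on {0..T}"
          by (auto intro!: integrable_continuous_interval continuous_intros contP contQ)
        then have "(\<zeta> has_integral integral {0..T} (\<lambda>t. (P t)\<^sup>2) + integral {0..T} (\<lambda>t. (Q t)\<^sup>2) +
            (T - 0) *\<^sub>R (B * r\<^sup>2)) {0..T}"
          unfolding \<zeta>_def using T_pos
          by (intro has_integral_add integrable_integral has_integral_const_real[THEN has_integral_eq_rhs]) auto
        then show ?thesis
          by (simp add: J_def P_def Q_def integral_unique)
      qed
      moreover have "e 0 = (a - a1)\<^sup>2 + (b - b1)\<^sup>2"
        using solution_simps(1,2)[OF p1'] by (simp add: e_def \<alpha>_def \<beta>_def w0 v0 p1_eq)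
      moreover have "B * r\<^sup>2 * T \<le> (B * T) * \<delta>"
      proof -
        have "r\<^sup>2 \<le> \<delta>" using sq zero_le_power2[of "a - a1"] zero_le_power2[of "b - b1"] by linarith
        from mult_left_mono[OF this BT] show ?thesis by (simp add: mult_ac)
      qed
      ultimately have "e 0 + integral {0..T} \<zeta> \<le> (2 + B * T) * \<delta>"
        using sq J zero_le_power2[of r] distrib_right[of 2 "B * T" \<delta>] by linarith
      also have "\<dots> \<le> (2 + B * T) * (\<epsilon> / (2 + B * T))"
        using BT by (intro mult_left_mono) (auto simp: \<delta>_def)
      also have "\<dots> = \<epsilon>" using BT by simp
      finally show "e 0 + integral {0..T} \<zeta> \<le> \<epsilon>" .
      show "exp (K * T) * \<epsilon> < 1" using exp\<epsilon> by simp
    qed (rule t)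
    also have "\<dots> \<le> \<eta>\<^sup>2" using exp\<epsilon> by simp
    finally have "(\<alpha> t)\<^sup>2 + (\<beta> t)\<^sup>2 \<le> \<eta>\<^sup>2" by (simp add: e_def)
    then have "(\<alpha> t)\<^sup>2 \<le> \<eta>\<^sup>2" "(\<beta> t)\<^sup>2 \<le> \<eta>\<^sup>2"
      using zero_le_power2[of "\<alpha> t"] zero_le_power2[of "\<beta> t"] by linarith+
    then show "\<bar>w t - xs p1 t\<bar> \<le> \<eta> \<and> \<bar>v t - zs p1 t\<bar> \<le> \<eta>"
      unfolding \<alpha>_def \<beta>_def using \<eta> by (simp add: abs_le_square_iff[symmetric])
  qed
qed

end

section \<open>The profiled fit follows the trajectory\<close>

lemma C1_dist_less_D:
  assumes "C1_dist T u w < ennreal r" "t \<in> {0..T}"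
  shows "\<bar>u t - w t\<bar> \<le> r" "\<bar>ddt T u t - ddt T w t\<bar> \<le> r"
proof -
  have "ennreal \<bar>u t - w t\<bar> \<le> sup_norm T (\<lambda>t. u t - w t)"
    "ennreal \<bar>ddt T u t - ddt T w t\<bar> \<le> sup_norm T (\<lambda>t. ddt T u t - ddt T w t)"
    unfolding sup_norm_def using assms(2) by (auto intro: SUP_upper)
  moreover have "sup_norm T (\<lambda>t. u t - w t) < ennreal r"
    "sup_norm T (\<lambda>t. ddt T u t - ddt T w t) < ennreal r"
    using assms(1) by (auto simp: C1_dist_def)
  ultimately have "ennreal \<bar>u t - w t\<bar> < ennreal r" "ennreal \<bar>ddt T u t - ddt T w t\<bar> < ennreal r"
    by (auto intro: le_less_trans)
  then show "\<bar>u t - w t\<bar> \<le> r" "\<bar>ddt T u t - ddt T w t\<bar> \<le> r"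
    by (auto simp: ennreal_less_iff)
qed

lemma approx_error_less_D:
  assumes "approx_error T L xs zs \<Theta>0 \<Gamma>0 < r" "\<theta> \<in> \<Theta>0" "(a, b) \<in> \<Gamma>0"
  obtains w v where "w \<in> L" "w 0 = a" "C1_dist T (xs (\<theta>, a, b)) w < r"
    "v \<in> L" "v 0 = b" "C1_dist T (zs (\<theta>, a, b)) v < r"
proof -
  let ?X = "\<lambda>(\<theta>, x, z). INF w\<in>{w\<in>L. w 0 = x}. C1_dist T (xs (\<theta>, x, z)) w"
  let ?Z = "\<lambda>(\<theta>, x, z). INF v\<in>{v\<in>L. v 0 = z}. C1_dist T (zs (\<theta>, x, z)) v"
  have p: "(\<theta>, a, b) \<in> \<Theta>0 \<times> \<Gamma>0" using assms by simp
  have "?X (\<theta>, a, b) < r" "?Z (\<theta>, a, b) < r"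
    using assms(1) SUP_upper[OF p, of ?X] SUP_upper[OF p, of ?Z]
    unfolding approx_error_def by (auto intro: le_less_trans)
  then show ?thesis using that by (auto simp: INF_less_iff)
qed

context parametric_ivp
begin

text \<open>
  Near \<open>p1\<close> all trajectories lie in one box, by continuous dependence, and there the vector field
  is Lipschitz.  A curve of the sieve that is \<open>r\<close>-close in \<open>C\<^sup>1\<close> to a trajectory therefore has
  defect of order \<open>r\<close> at every time, and penalty of order \<open>r\<^sup>2\<close>.  Closed balls around the
  components of \<open>p1\<close> are the compact sets to which the approximation hypothesis is applied.
\<close>

lemma approximants_with_small_penalty:
  assumes L: "\<And>n. n \<ge> 1 \<Longrightarrow> fin_dim_C1_subspace T (L n)"
    and approx: "\<And>\<Theta>0 \<Gamma>0. compact \<Theta>0 \<Longrightarrow> \<Theta>0 \<subseteq> \<Theta> \<Longrightarrow> compact \<Gamma>0 \<Longrightarrow> \<Gamma>0 \<subseteq> \<Gamma> \<Longrightarrow>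
         (\<lambda>n. approx_error T (L n) xs zs \<Theta>0 \<Gamma>0) \<longlonglongrightarrow> 0"
    and p1: "p1 \<in> \<Theta> \<times> \<Gamma>" and \<delta>: "\<delta> > 0"
  obtains \<rho> R where "\<rho> > 0"
    "\<forall>\<^sub>F n in sequentially. \<forall>\<theta> a b. (\<theta>, a, b) \<in> ball p1 \<rho> \<longrightarrow>
       (\<exists>w\<in>L n. \<exists>v\<in>L n. w 0 = a \<and> v 0 = b \<and> J T F G w v \<theta> \<le> \<delta> \<and> (\<forall>t\<in>{0..T}. \<bar>w t\<bar> \<le> R))"
proof -
  obtain \<theta>1 a1 b1 where p1_eq: "p1 = (\<theta>1, a1, b1)" by (cases p1)
  have in1: "\<theta>1 \<in> \<Theta>" "(a1, b1) \<in> \<Gamma>" using p1 p1_eq by auto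
  obtain R1 where "R1 \<ge> 0" and R1: "\<And>t. t \<in> {0..T} \<Longrightarrow> \<bar>xs p1 t\<bar> \<le> R1" "\<And>t. t \<in> {0..T} \<Longrightarrow> \<bar>zs p1 t\<bar> \<le> R1"
    using bounded_solution[OF p1] by blast
  obtain \<delta>1 where \<delta>1: "\<delta>1 > 0"
    "\<And>\<theta> a b w v t. (\<theta>, a, b) \<in> \<Theta> \<times> \<Gamma> \<Longrightarrow> dist (\<theta>, a, b) p1 < \<delta>1 \<Longrightarrow> C1 T w \<Longrightarrow> C1 T v \<Longrightarrow>
       w 0 = a \<Longrightarrow> v 0 = b \<Longrightarrow> J T F G w v \<theta> \<le> \<delta>1 \<Longrightarrow> t \<in> {0..T} \<Longrightarrow>
       \<bar>w t - xs p1 t\<bar> \<le> 1 \<and> \<bar>v t - zs p1 t\<bar> \<le> 1"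
    using stability[OF p1 zero_less_one] by blast
  obtain \<rho>1 where \<rho>1: "\<rho>1 > 0" "cball \<theta>1 \<rho>1 \<subseteq> \<Theta>"
    using open_Theta in1 open_contains_cball by blast
  obtain \<rho>2 where \<rho>2: "\<rho>2 > 0" "cball (a1, b1) \<rho>2 \<subseteq> \<Gamma>"
    using open_Gamma in1 open_contains_cball by blast
  define \<rho> where "\<rho> = min \<delta>1 (min \<rho>1 \<rho>2)"
  have \<rho>: "\<rho> > 0" "cball \<theta>1 \<rho> \<subseteq> \<Theta>" "cball (a1, b1) \<rho> \<subseteq> \<Gamma>"
    using \<delta>1(1) \<rho>1 \<rho>2 by (auto simp: \<rho>_def subset_eq)
  define R where "R = R1 + 2"
  obtain BF where BF: "BF \<ge> 0" "\<forall>x\<in>{-R..R}. \<forall>z\<in>{-R..R}. \<forall>x'\<in>{-R..R}. \<forall>z'\<in>{-R..R}.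
      \<forall>t\<in>{0..T}. \<forall>\<theta>\<in>cball \<theta>1 \<rho>. \<forall>\<theta>'\<in>cball \<theta>1 \<rho>.
       (F x z t \<theta> - F x' z' t \<theta>')\<^sup>2 \<le> BF * ((x - x')\<^sup>2 + (z - z')\<^sup>2 + (dist \<theta> \<theta>')\<^sup>2)"
    using lipschitz_on_box[OF F_C1 \<rho>(2), of R] by blast
  obtain BG where BG: "BG \<ge> 0" "\<forall>x\<in>{-R..R}. \<forall>z\<in>{-R..R}. \<forall>x'\<in>{-R..R}. \<forall>z'\<in>{-R..R}.
      \<forall>t\<in>{0..T}. \<forall>\<theta>\<in>cball \<theta>1 \<rho>. \<forall>\<theta>'\<in>cball \<theta>1 \<rho>.
       (G x z t \<theta> - G x' z' t \<theta>')\<^sup>2 \<le> BG * ((x - x')\<^sup>2 + (z - z')\<^sup>2 + (dist \<theta> \<theta>')\<^sup>2)"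
    using lipschitz_on_box[OF G_C1 \<rho>(2), of R] by blast
  define A where "A = T * (4 + 4 * BF + 4 * BG)"
  have A: "A > 0" using T_pos BF(1) BG(1) by (simp add: A_def)
  define r where "r = min 1 (\<delta> / A)"
  have r: "0 < r" "r \<le> 1" using A \<delta> by (auto simp: r_def)
  have rA: "A * r\<^sup>2 \<le> \<delta>"
  proof -
    have "r\<^sup>2 \<le> r" using r mult_left_mono[of r 1 r] by (simp add: power2_eq_square)
    also have "\<dots> \<le> \<delta> / A" by (simp add: r_def)
    finally show ?thesis using A by (simp add: field_simps)
  qed
  have defect: "integral {0..T} (\<lambda>t. (d t - V (w t) (v t) t \<theta>)\<^sup>2) \<le> T * (2 + 4 * B) * r\<^sup>2"
    if V: "Ck_on 1 (UNIV \<times> UNIV \<times> {0..T} \<times> \<Theta>) (\<lambda>(x, z, t, \<theta>). V x z t \<theta>)"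
      and B: "B \<ge> 0" "\<forall>x\<in>{-R..R}. \<forall>z\<in>{-R..R}. \<forall>x'\<in>{-R..R}. \<forall>z'\<in>{-R..R}.
      \<forall>t\<in>{0..T}. \<forall>\<theta>\<in>cball \<theta>1 \<rho>. \<forall>\<theta>'\<in>cball \<theta>1 \<rho>.
       (V x z t \<theta> - V x' z' t \<theta>')\<^sup>2 \<le> B * ((x - x')\<^sup>2 + (z - z')\<^sup>2 + (dist \<theta> \<theta>')\<^sup>2)"
      and \<theta>: "\<theta> \<in> cball \<theta>1 \<rho>"
      and cont: "continuous_on {0..T} d" "continuous_on {0..T} w" "continuous_on {0..T} v"
      and d: "\<And>t. t \<in> {0..T} \<Longrightarrow> \<bar>V (x t) (z t) t \<theta> - d t\<bar> \<le> r"
      and close: "\<And>t. t \<in> {0..T} \<Longrightarrow> \<bar>x t - w t\<bar> \<le> r" "\<And>t. t \<in> {0..T} \<Longrightarrow> \<bar>z t - v t\<bar> \<le> r"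
      and bd: "\<And>t. t \<in> {0..T} \<Longrightarrow> x t \<in> {-R..R} \<and> z t \<in> {-R..R} \<and> w t \<in> {-R..R} \<and> v t \<in> {-R..R}"
    for V B \<theta> d w v x z
  proof -
    have \<theta>': "\<theta> \<in> \<Theta>" using \<theta> \<rho>(2) by auto
    have pt: "(d t - V (w t) (v t) t \<theta>)\<^sup>2 \<le> (2 + 4 * B) * r\<^sup>2" if t: "t \<in> {0..T}" for t
    proof -
      have sq: "(V (x t) (z t) t \<theta> - d t)\<^sup>2 \<le> r\<^sup>2" "(x t - w t)\<^sup>2 \<le> r\<^sup>2" "(z t - v t)\<^sup>2 \<le> r\<^sup>2"
        using d[OF t] close[OF t] r(1) by (auto simp: abs_le_square_iff[symmetric])
      have "(V (x t) (z t) t \<theta> - V (w t) (v t) t \<theta>)\<^sup>2 \<le> B * ((x t - w t)\<^sup>2 + (z t - v t)\<^sup>2)"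
        using B(2)[rule_format, of "x t" "z t" "w t" "v t" t \<theta> \<theta>] bd[OF t] t \<theta> by simp
      also have "\<dots> \<le> B * (r\<^sup>2 + r\<^sup>2)" using sq B(1) by (intro mult_left_mono) auto
      finally have v: "(V (x t) (z t) t \<theta> - V (w t) (v t) t \<theta>)\<^sup>2 \<le> B * (r\<^sup>2 + r\<^sup>2)" .
      have "(c - k)\<^sup>2 \<le> 2 * (u - c)\<^sup>2 + 2 * (u - k)\<^sup>2" for u c k :: real
        using zero_le_power2[of "(u - c) + (u - k)"] by (simp add: power2_eq_square algebra_simps)
      then have "(d t - V (w t) (v t) t \<theta>)\<^sup>2 \<le>
          2 * (V (x t) (z t) t \<theta> - d t)\<^sup>2 + 2 * (V (x t) (z t) t \<theta> - V (w t) (v t) t \<theta>)\<^sup>2" .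
      also have "\<dots> \<le> 2 * r\<^sup>2 + 2 * (B * (r\<^sup>2 + r\<^sup>2))" using sq v by linarith
      finally show ?thesis by (simp add: algebra_simps)
    qed
    have "integral {0..T} (\<lambda>t. (d t - V (w t) (v t) t \<theta>)\<^sup>2) \<le> integral {0..T} (\<lambda>t. (2 + 4 * B) * r\<^sup>2)"
      using pt by (intro integral_le integrable_continuous_interval continuous_intros cont
          continuous_on_along[OF V _ _ \<theta>']) auto
    also have "\<dots> = T * (2 + 4 * B) * r\<^sup>2" using T_pos by simp
    finally show ?thesis .
  qed
  show ?thesis
  proof (rule that[OF \<rho>(1), of R])
    have "\<forall>\<^sub>F n in sequentially. approx_error T (L n) xs zs (cball \<theta>1 \<rho>) (cball (a1, b1) \<rho>) < ennreal r"
      using r(1) by (intro order_tendstoD[OF approx] \<rho>) auto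
    moreover have "\<forall>\<^sub>F n in sequentially. n \<ge> (1::nat)" by (rule eventually_ge_at_top)
    ultimately show "\<forall>\<^sub>F n in sequentially. \<forall>\<theta> a b. (\<theta>, a, b) \<in> ball p1 \<rho> \<longrightarrow>
       (\<exists>w\<in>L n. \<exists>v\<in>L n. w 0 = a \<and> v 0 = b \<and> J T F G w v \<theta> \<le> \<delta> \<and> (\<forall>t\<in>{0..T}. \<bar>w t\<bar> \<le> R))"
    proof eventually_elim
      case (elim n)
      show ?case
      proof (intro allI impI)
        fix \<theta> a b assume pb: "(\<theta>, a, b) \<in> ball p1 \<rho>"
        have "dist \<theta>1 \<theta> \<le> dist p1 (\<theta>, a, b)" "dist (a1, b1) (a, b) \<le> dist p1 (\<theta>, a, b)"
          unfolding p1_eq dist_Pair_Pair[of \<theta>1 "(a1, b1)"] by (rule real_le_rsqrt; simp)+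
        then have cb: "\<theta> \<in> cball \<theta>1 \<rho>" "(a, b) \<in> cball (a1, b1) \<rho>" using pb by auto
        then have p: "(\<theta>, a, b) \<in> \<Theta> \<times> \<Gamma>" using \<rho> by auto
        obtain w v where w: "w \<in> L n" "w 0 = a" "C1_dist T (xs (\<theta>, a, b)) w < ennreal r"
          and v: "v \<in> L n" "v 0 = b" "C1_dist T (zs (\<theta>, a, b)) v < ennreal r"
          using approx_error_less_D[OF elim(1) cb] by blast
        have C: "C1 T w" "C1 T v"
          using w v L[OF elim(2)] fin_dim_C1_subspace_imp_C1 by blast+
        have near: "\<bar>xs (\<theta>, a, b) t - xs p1 t\<bar> \<le> 1 \<and> \<bar>zs (\<theta>, a, b) t - zs p1 t\<bar> \<le> 1"
          if "t \<in> {0..T}" for t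
          using that pb \<delta>1(1) J_solution[OF p] C1_solution[OF p] solution_simps(1,2)[OF p]
          by (intro \<delta>1(2)[OF p]) (auto simp: \<rho>_def dist_commute)
        have bd: "xs (\<theta>, a, b) t \<in> {-R..R} \<and> zs (\<theta>, a, b) t \<in> {-R..R} \<and> w t \<in> {-R..R} \<and> v t \<in> {-R..R}"
          if t: "t \<in> {0..T}" for t
          using near[OF t] R1(1)[OF t] R1(2)[OF t] r(2)
            C1_dist_less_D(1)[OF w(3) t] C1_dist_less_D(1)[OF v(3) t]
          unfolding R_def by auto
        have "integral {0..T} (\<lambda>t. (ddt T w t - F (w t) (v t) t \<theta>)\<^sup>2) \<le> T * (2 + 4 * BF) * r\<^sup>2"
          using C1_dist_less_D(2)[OF w(3)] ddt_solution(1)[OF p] C1D(1)[OF T_pos C(1)]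
            C1_imp_continuous_on C C1_dist_less_D(1)[OF w(3)] C1_dist_less_D(1)[OF v(3)] bd
          by (intro defect[OF F_C1 BF cb(1), of _ _ _ "xs (\<theta>, a, b)" "zs (\<theta>, a, b)"]) auto
        moreover have "integral {0..T} (\<lambda>t. (ddt T v t - G (w t) (v t) t \<theta>)\<^sup>2) \<le> T * (2 + 4 * BG) * r\<^sup>2"
          using C1_dist_less_D(2)[OF v(3)] ddt_solution(2)[OF p] C1D(1)[OF T_pos C(2)]
            C1_imp_continuous_on C C1_dist_less_D(1)[OF w(3)] C1_dist_less_D(1)[OF v(3)] bd
          by (intro defect[OF G_C1 BG cb(1), of _ _ _ "xs (\<theta>, a, b)" "zs (\<theta>, a, b)"]) auto
        ultimately have "J T F G w v \<theta> \<le> T * (2 + 4 * BF) * r\<^sup>2 + T * (2 + 4 * BG) * r\<^sup>2"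
          unfolding J_def by linarith
        also have "\<dots> = A * r\<^sup>2" by (simp add: A_def algebra_simps)
        finally have "J T F G w v \<theta> \<le> \<delta>" using rA by simp
        moreover have "\<bar>w t\<bar> \<le> R" if "t \<in> {0..T}" for t using bd[OF that] by auto
        ultimately show "\<exists>w\<in>L n. \<exists>v\<in>L n. w 0 = a \<and> v 0 = b \<and> J T F G w v \<theta> \<le> \<delta> \<and> (\<forall>t\<in>{0..T}. \<bar>w t\<bar> \<le> R)"
          using w v by blast
      qed
    qed
  qed
qed

text \<open>
  The optimal criterion is compared with its value at an approximant of small penalty.  Since
  \<open>H \<le> 0\<close>, this gives \<open>lam n * J \<le> - H w + lam n * (small)\<close>, where \<open>w\<close> is the approximant; dividing by
  \<open>lam n\<close>, the penalty of the fit is small as soon as \<open>- H\<close> is at most a small multiple of \<open>lam n\<close> on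
  bounded curves, and stability applies.  The functional \<open>H\<close> is arbitrary, which keeps randomness
  out of the argument: the exceptional event is the one on which the bound for \<open>- H\<close> fails.
\<close>

lemma profile_fit_near_trajectory:
  assumes L: "\<And>n. n \<ge> 1 \<Longrightarrow> fin_dim_C1_subspace T (L n)"
    and lam: "\<And>n. n \<ge> 1 \<Longrightarrow> lam n > (0::real)"
    and approx: "\<And>\<Theta>0 \<Gamma>0. compact \<Theta>0 \<Longrightarrow> \<Theta>0 \<subseteq> \<Theta> \<Longrightarrow> compact \<Gamma>0 \<Longrightarrow> \<Gamma>0 \<subseteq> \<Gamma> \<Longrightarrow>
         (\<lambda>n. approx_error T (L n) xs zs \<Theta>0 \<Gamma>0) \<longlonglongrightarrow> 0"
    and p1: "p1 \<in> \<Theta> \<times> \<Gamma>" and \<eta>: "\<eta> > 0"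
  shows "\<exists>\<rho>>0. \<exists>c>0. \<exists>R. \<forall>\<^sub>F n in sequentially. \<forall>H. \<forall>p\<in>(\<Theta> \<times> \<Gamma>) \<inter> ball p1 \<rho>. \<forall>x z.
       (\<forall>w. H w \<le> 0) \<longrightarrow> (\<forall>w. (\<forall>t\<in>{0..T}. \<bar>w t\<bar> \<le> R) \<longrightarrow> - H w \<le> c * lam n) \<longrightarrow>
       profile_maximizer T F G H (lam n) (L n) p (x, z) \<longrightarrow>
       (\<forall>t\<in>{0..T}. \<bar>x t - xs p1 t\<bar> \<le> \<eta>)"
proof -
  obtain \<delta> where \<delta>: "\<delta> > 0"
    "\<And>\<theta> a b w v t. (\<theta>, a, b) \<in> \<Theta> \<times> \<Gamma> \<Longrightarrow> dist (\<theta>, a, b) p1 < \<delta> \<Longrightarrow> C1 T w \<Longrightarrow> C1 T v \<Longrightarrow>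
       w 0 = a \<Longrightarrow> v 0 = b \<Longrightarrow> J T F G w v \<theta> \<le> \<delta> \<Longrightarrow> t \<in> {0..T} \<Longrightarrow>
       \<bar>w t - xs p1 t\<bar> \<le> \<eta> \<and> \<bar>v t - zs p1 t\<bar> \<le> \<eta>"
    using stability[OF p1 \<eta>] by blast
  from \<delta>(1) have "\<delta> / 2 > 0" by simp
  then obtain \<rho> R where \<rho>: "\<rho> > 0"
    "\<forall>\<^sub>F n in sequentially. \<forall>\<theta> a b. (\<theta>, a, b) \<in> ball p1 \<rho> \<longrightarrow>
       (\<exists>w\<in>L n. \<exists>v\<in>L n. w 0 = a \<and> v 0 = b \<and> J T F G w v \<theta> \<le> \<delta> / 2 \<and> (\<forall>t\<in>{0..T}. \<bar>w t\<bar> \<le> R))"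
    using approximants_with_small_penalty[OF L approx p1, of "\<delta> / 2"] by blast
  have \<rho>\<delta>: "min \<rho> \<delta> > 0" "\<delta> / 2 > 0" using \<rho> \<delta> by auto
  have "\<forall>\<^sub>F n in sequentially. n \<ge> (1::nat)" by (rule eventually_ge_at_top)
  with \<rho>(2) have "\<forall>\<^sub>F n in sequentially. \<forall>H. \<forall>p\<in>(\<Theta> \<times> \<Gamma>) \<inter> ball p1 (min \<rho> \<delta>). \<forall>x z.
       (\<forall>w. H w \<le> 0) \<longrightarrow> (\<forall>w. (\<forall>t\<in>{0..T}. \<bar>w t\<bar> \<le> R) \<longrightarrow> - H w \<le> \<delta> / 2 * lam n) \<longrightarrow>
       profile_maximizer T F G H (lam n) (L n) p (x, z) \<longrightarrow>
       (\<forall>t\<in>{0..T}. \<bar>x t - xs p1 t\<bar> \<le> \<eta>)"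
  proof eventually_elim
    case (elim n)
    show ?case
    proof (intro allI ballI impI)
      fix H p x z t
      assume p: "p \<in> (\<Theta> \<times> \<Gamma>) \<inter> ball p1 (min \<rho> \<delta>)" and H0: "\<forall>w. H w \<le> 0"
        and H: "\<forall>w. (\<forall>t\<in>{0..T}. \<bar>w t\<bar> \<le> R) \<longrightarrow> - H w \<le> \<delta> / 2 * lam n"
        and max: "profile_maximizer T F G H (lam n) (L n) p (x, z)" and t: "t \<in> {0..T}"
      obtain \<theta> a b where p_eq: "p = (\<theta>, a, b)" by (cases p)
      have xz: "x \<in> L n" "z \<in> L n" "x 0 = a" "z 0 = b"
        and opt: "\<And>w v. w \<in> L n \<Longrightarrow> v \<in> L n \<Longrightarrow> w 0 = a \<Longrightarrow> v 0 = b \<Longrightarrow>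
          H w - lam n * J T F G w v \<theta> \<le> H x - lam n * J T F G x z \<theta>"
        using max unfolding profile_maximizer_def p_eq is_arg_max_linorder by auto
      obtain w v where wv: "w \<in> L n" "v \<in> L n" "w 0 = a" "v 0 = b" "J T F G w v \<theta> \<le> \<delta> / 2"
        "\<forall>t\<in>{0..T}. \<bar>w t\<bar> \<le> R"
        using elim(1) p p_eq by fastforce
      have "lam n * J T F G x z \<theta> \<le> H x - H w + lam n * J T F G w v \<theta>"
        using opt[OF wv(1-4)] by linarith
      also have "\<dots> \<le> 0 + \<delta> / 2 * lam n + lam n * (\<delta> / 2)"
      proof -
        have "lam n * J T F G w v \<theta> \<le> lam n * (\<delta> / 2)"
          using lam[OF elim(2)] by (intro mult_left_mono[OF wv(5)]) simp
        moreover have "- H w \<le> \<delta> / 2 * lam n" using H wv(6) by blast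
        ultimately show ?thesis using H0[rule_format, of x] by linarith
      qed
      also have "\<dots> = lam n * \<delta>" by simp
      finally have J: "J T F G x z \<theta> \<le> \<delta>" using lam[OF elim(2)] by simp
      have "C1 T x" "C1 T z" using xz L[OF elim(2)] fin_dim_C1_subspace_imp_C1 by blast+
      then show "\<bar>x t - xs p1 t\<bar> \<le> \<eta>"
        using \<delta>(2)[of \<theta> a b x z t] p p_eq xz J t by (simp add: dist_commute)
    qed
  qed
  with \<rho>\<delta> show ?thesis by blast
qed

end

section \<open>Sample means\<close>

definition sample_mean :: "(nat \<Rightarrow> 'w \<Rightarrow> 'b) \<Rightarrow> ('b \<Rightarrow> real) \<Rightarrow> nat \<Rightarrow> 'w \<Rightarrow> real" where
  "sample_mean Z h n \<omega> = (\<Sum>i<n. h (Z i \<omega>)) / real n"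

lemma sample_mean_mono:
  "(\<And>i. h (Z i \<omega>) \<le> k (Z i \<omega>)) \<Longrightarrow> sample_mean Z h n \<omega> \<le> sample_mean Z k n \<omega>"
  unfolding sample_mean_def by (intro divide_right_mono sum_mono) auto

lemma sample_mean_add:
  "sample_mean Z (\<lambda>z. h z + k z) n \<omega> = sample_mean Z h n \<omega> + sample_mean Z k n \<omega>"
  unfolding sample_mean_def by (simp add: sum.distrib add_divide_distrib)

locale iid_sample = prob_space P for P :: "'w measure" +
  fixes Z :: "nat \<Rightarrow> 'w \<Rightarrow> real \<times> real"
  assumes iid_Z: "iid P Z"
begin

lemma indep_Z: "indep_vars (\<lambda>_. borel) Z UNIV"
  and distr_Z: "distr P borel (Z i) = distr P borel (Z 0)"
  using iid_Z unfolding iid_def by auto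

lemma Z_measurable [measurable]: "Z i \<in> borel_measurable P"
  using indep_Z unfolding indep_vars_def by auto

lemma sample_mean_measurable [measurable]:
  assumes [measurable]: "h \<in> borel_measurable borel"
  shows "sample_mean Z h n \<in> borel_measurable P"
  unfolding sample_mean_def[abs_def] by measurable

lemma integrable_Z:
  assumes [measurable]: "h \<in> borel_measurable borel"
    and int: "integrable P (\<lambda>\<omega>. h (Z 0 \<omega>) :: real)"
  shows "integrable P (\<lambda>\<omega>. h (Z i \<omega>))" "expectation (\<lambda>\<omega>. h (Z i \<omega>)) = expectation (\<lambda>\<omega>. h (Z 0 \<omega>))"
proof -
  have "integrable (distr P borel (Z 0)) h" using int by (subst integrable_distr_eq) auto
  then have "integrable (distr P borel (Z i)) h" by (simp only: distr_Z[of i])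
  then show "integrable P (\<lambda>\<omega>. h (Z i \<omega>))" by (subst (asm) integrable_distr_eq) auto
  have "expectation (\<lambda>\<omega>. h (Z j \<omega>)) = integral\<^sup>L (distr P borel (Z j)) h" for j
    by (subst integral_distr) auto
  then show "expectation (\<lambda>\<omega>. h (Z i \<omega>)) = expectation (\<lambda>\<omega>. h (Z 0 \<omega>))"
    using distr_Z[of i] by simp
qed

lemma sample_mean_Markov:
  assumes [measurable]: "h \<in> borel_measurable borel" and nonneg: "\<And>z. h z \<ge> 0"
    and int: "integrable P (\<lambda>\<omega>. h (Z 0 \<omega>))" and a: "a > 0" and n: "n \<ge> 1"
  shows "prob {\<omega>\<in>space P. sample_mean Z h n \<omega> \<ge> a} \<le> expectation (\<lambda>\<omega>. h (Z 0 \<omega>)) / a"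
proof -
  note Zi = integrable_Z[OF assms(1) int]
  have "integrable P (sample_mean Z h n)"
    unfolding sample_mean_def[abs_def] using Zi(1) by (intro integrable_divide Bochner_Integration.integrable_sum)
  moreover have "expectation (sample_mean Z h n) = expectation (\<lambda>\<omega>. h (Z 0 \<omega>))"
  proof -
    have "expectation (\<lambda>\<omega>. \<Sum>i<n. h (Z i \<omega>)) = (\<Sum>i<n. expectation (\<lambda>\<omega>. h (Z i \<omega>)))"
      by (rule Bochner_Integration.integral_sum) (rule Zi(1))
    also have "\<dots> = (\<Sum>i<n. expectation (\<lambda>\<omega>. h (Z 0 \<omega>)))"
      by (intro sum.cong refl Zi(2))
    finally show ?thesis using n by (simp add: sample_mean_def[abs_def])
  qed
  moreover have "AE \<omega> in P. 0 \<le> sample_mean Z h n \<omega>"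
    unfolding sample_mean_def by (intro AE_I2 divide_nonneg_nonneg sum_nonneg nonneg) simp
  ultimately show ?thesis
    using integral_Markov_inequality_measure[of P "sample_mean Z h n" "{}" a, OF _ _ _ a] by auto
qed

text \<open>
  Hoeffding's inequality bounds both tails geometrically in \<open>n\<close>.
\<close>

lemma sample_mean_bounded_tails:
  assumes [measurable]: "h \<in> borel_measurable borel" and bd: "\<And>z. 0 \<le> h z" "\<And>z. h z \<le> m"
    and \<epsilon>: "\<epsilon> > 0"
  shows "(\<lambda>n. prob {\<omega>\<in>space P. sample_mean Z h n \<omega> \<ge> expectation (\<lambda>\<omega>. h (Z 0 \<omega>)) + \<epsilon>}) \<longlonglongrightarrow> 0"
    and "(\<lambda>n. prob {\<omega>\<in>space P. sample_mean Z h n \<omega> \<le> expectation (\<lambda>\<omega>. h (Z 0 \<omega>)) - \<epsilon>}) \<longlonglongrightarrow> 0"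
proof -
  define b where "b = max m 1"
  define \<mu> where "\<mu> = expectation (\<lambda>\<omega>. h (Z 0 \<omega>))"
  define r where "r = exp (- 2 * \<epsilon>\<^sup>2 / b\<^sup>2)"
  have b: "b > 0" by (simp add: b_def)
  have r: "0 < r" "r < 1" using b \<epsilon> by (auto simp: r_def)
  have lim: "(\<lambda>n. r ^ n) \<longlonglongrightarrow> 0" using r by (intro LIMSEQ_power_zero) auto
  have *: "prob {\<omega>\<in>space P. sample_mean Z h n \<omega> \<ge> \<mu> + \<epsilon>} \<le> r ^ n \<and>
           prob {\<omega>\<in>space P. sample_mean Z h n \<omega> \<le> \<mu> - \<epsilon>} \<le> r ^ n" if n: "n \<ge> 1" for n
  proof -
    interpret Hoeffding_ineq_iid P "{..<n}" "\<lambda>i \<omega>. h (Z i \<omega>)" "\<lambda>\<omega>. h (Z 0 \<omega>)" 0 b \<mu>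
    proof unfold_locales
      show "indep_vars (\<lambda>_. borel) (\<lambda>i \<omega>. h (Z i \<omega>)) {..<n}"
        by (rule indep_vars_compose2[OF indep_vars_subset[OF indep_Z]]) auto
      show "distr P borel (\<lambda>\<omega>. h (Z i \<omega>)) = distr P borel (\<lambda>\<omega>. h (Z 0 \<omega>))" for i
      proof -
        have "distr P borel (\<lambda>\<omega>. h (Z j \<omega>)) = distr (distr P borel (Z j)) borel h" for j
          by (subst distr_distr) (auto simp: comp_def)
        then show ?thesis by (simp only: distr_Z[of i])
      qed
      show "AE x in P. h (Z 0 x) \<in> {0..b}" using bd by (auto simp: b_def le_max_iff_disj)
    qed (auto simp: \<mu>_def)
    have e: "exp (- 2 * (n * \<epsilon>)\<^sup>2 / (n * b\<^sup>2)) = r ^ n"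
    proof -
      have "r ^ n = exp (n * (- 2 * \<epsilon>\<^sup>2 / b\<^sup>2))" unfolding r_def by (rule exp_of_nat_mult[symmetric])
      also have "n * (- 2 * \<epsilon>\<^sup>2 / b\<^sup>2) = - 2 * (n * \<epsilon>)\<^sup>2 / (n * b\<^sup>2)"
        using n by (simp add: power2_eq_square field_simps)
      finally show ?thesis by simp
    qed
    have ev: "sample_mean Z h n \<omega> \<ge> \<mu> + \<epsilon> \<longleftrightarrow> (\<Sum>i<n. h (Z i \<omega>)) \<ge> n * \<mu> + n * \<epsilon>"
      "sample_mean Z h n \<omega> \<le> \<mu> - \<epsilon> \<longleftrightarrow> (\<Sum>i<n. h (Z i \<omega>)) \<le> n * \<mu> - n * \<epsilon>" for \<omega>
      using n by (auto simp: sample_mean_def field_simps)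
    show ?thesis
      unfolding ev
      using Hoeffding_ineq_ge[of "n * \<epsilon>"] Hoeffding_ineq_le[of "n * \<epsilon>"] n b \<epsilon> e
      by (auto simp: lessThan_empty_iff)
  qed
  show "(\<lambda>n. prob {\<omega>\<in>space P. sample_mean Z h n \<omega> \<ge> expectation (\<lambda>\<omega>. h (Z 0 \<omega>)) + \<epsilon>}) \<longlonglongrightarrow> 0"
    "(\<lambda>n. prob {\<omega>\<in>space P. sample_mean Z h n \<omega> \<le> expectation (\<lambda>\<omega>. h (Z 0 \<omega>)) - \<epsilon>}) \<longlonglongrightarrow> 0"
    unfolding \<mu>_def[symmetric]
    by (rule tendsto_sandwich[OF _ _ tendsto_const lim];
        use * in \<open>auto intro: eventually_sequentiallyI[of 1]\<close>)+
qed

text \<open>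
  The upper half of the weak law of large numbers for nonnegative integrable functions.  The
  function is split at a high level \<open>m\<close>: the lower part is bounded, and the remainder has small
  expectation by dominated convergence, so that Markov's inequality suffices for it.
\<close>

lemma sample_mean_upper_tail:
  assumes [measurable]: "h \<in> borel_measurable borel" and nonneg: "\<And>z. h z \<ge> 0"
    and int: "integrable P (\<lambda>\<omega>. h (Z 0 \<omega>))" and c: "expectation (\<lambda>\<omega>. h (Z 0 \<omega>)) < c"
  shows "(\<lambda>n. prob {\<omega>\<in>space P. sample_mean Z h n \<omega> \<ge> c}) \<longlonglongrightarrow> 0"
proof (rule LIMSEQ_I)
  fix \<epsilon> :: real assume \<epsilon>: "\<epsilon> > 0"
  define s where "s = (c - expectation (\<lambda>\<omega>. h (Z 0 \<omega>))) / 2"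
  have s: "s > 0" using c by (simp add: s_def)
  define low where "low m z = min (h z) (real m)" for m z
  define tail where "tail m z = h z - low m z" for m z
  have [measurable]: "low m \<in> borel_measurable borel" "tail m \<in> borel_measurable borel" for m
    unfolding low_def[abs_def] tail_def[abs_def] by measurable
  have low: "0 \<le> low m z" "low m z \<le> m" "low m z \<le> h z" for m z
    using nonneg by (auto simp: low_def)
  have tail: "0 \<le> tail m z" "tail m z \<le> h z" for m z
    using low[of m z] by (auto simp: tail_def)
  have int_low: "integrable P (\<lambda>\<omega>. low m (Z 0 \<omega>))" and int_tail: "integrable P (\<lambda>\<omega>. tail m (Z 0 \<omega>))" for m
  proof -
    have "\<bar>low m (Z 0 \<omega>)\<bar> \<le> \<bar>h (Z 0 \<omega>)\<bar>" "\<bar>tail m (Z 0 \<omega>)\<bar> \<le> \<bar>h (Z 0 \<omega>)\<bar>" for \<omega>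
      using low[of m "Z 0 \<omega>"] tail[of m "Z 0 \<omega>"] nonneg[of "Z 0 \<omega>"] by linarith+
    then show "integrable P (\<lambda>\<omega>. low m (Z 0 \<omega>))" "integrable P (\<lambda>\<omega>. tail m (Z 0 \<omega>))"
      by (auto intro!: Bochner_Integration.integrable_bound[OF int])
  qed
  have "(\<lambda>m. expectation (\<lambda>\<omega>. tail m (Z 0 \<omega>))) \<longlonglongrightarrow> expectation (\<lambda>\<omega>. 0)"
  proof (rule integral_dominated_convergence[OF _ _ int])
    show "AE \<omega> in P. (\<lambda>m. tail m (Z 0 \<omega>)) \<longlonglongrightarrow> 0"
    proof (rule AE_I2)
      fix \<omega>
      obtain M :: nat where "h (Z 0 \<omega>) \<le> M" using real_arch_simple by blast
      then have "tail m (Z 0 \<omega>) = 0" if "m \<ge> M" for m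
        using that by (auto simp: tail_def low_def min_def)
      then show "(\<lambda>m. tail m (Z 0 \<omega>)) \<longlonglongrightarrow> 0"
        by (intro tendsto_eventually eventually_sequentiallyI[of M])
    qed
    show "AE \<omega> in P. norm (tail m (Z 0 \<omega>)) \<le> h (Z 0 \<omega>)" for m
      using tail[of m "Z 0 \<omega>" for \<omega>] by (intro AE_I2) simp
  qed measurable
  then have "\<forall>\<^sub>F m in sequentially. expectation (\<lambda>\<omega>. tail m (Z 0 \<omega>)) < s * \<epsilon> / 2"
    using s \<epsilon> by (intro order_tendstoD) auto
  then obtain m where m: "expectation (\<lambda>\<omega>. tail m (Z 0 \<omega>)) < s * \<epsilon> / 2"
    by (auto simp: eventually_sequentially)
  have "(\<lambda>n. prob {\<omega>\<in>space P. sample_mean Z (low m) n \<omega> \<ge> expectation (\<lambda>\<omega>. low m (Z 0 \<omega>)) + s}) \<longlonglongrightarrow> 0"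
    using low s by (intro sample_mean_bounded_tails) auto
  then have "\<forall>\<^sub>F n in sequentially.
      prob {\<omega>\<in>space P. sample_mean Z (low m) n \<omega> \<ge> expectation (\<lambda>\<omega>. low m (Z 0 \<omega>)) + s} < \<epsilon> / 2"
    using \<epsilon> by (intro order_tendstoD) auto
  then obtain N where N: "\<And>n. n \<ge> N \<Longrightarrow>
      prob {\<omega>\<in>space P. sample_mean Z (low m) n \<omega> \<ge> expectation (\<lambda>\<omega>. low m (Z 0 \<omega>)) + s} < \<epsilon> / 2"
    by (auto simp: eventually_sequentially)
  have "expectation (\<lambda>\<omega>. low m (Z 0 \<omega>)) \<le> expectation (\<lambda>\<omega>. h (Z 0 \<omega>))"
    using int_low int low by (intro integral_mono) auto
  then have le: "expectation (\<lambda>\<omega>. low m (Z 0 \<omega>)) + s + s \<le> c" by (simp add: s_def field_simps)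
  have "prob {\<omega>\<in>space P. sample_mean Z h n \<omega> \<ge> c} < \<epsilon>" if n: "n \<ge> max 1 N" for n
  proof -
    let ?A = "{\<omega>\<in>space P. sample_mean Z (low m) n \<omega> \<ge> expectation (\<lambda>\<omega>. low m (Z 0 \<omega>)) + s}"
    let ?B = "{\<omega>\<in>space P. sample_mean Z (tail m) n \<omega> \<ge> s}"
    have split: "sample_mean Z h n \<omega> = sample_mean Z (low m) n \<omega> + sample_mean Z (tail m) n \<omega>" for \<omega>
      using sample_mean_add[of Z "low m" "tail m" n \<omega>] by (simp add: tail_def)
    have "{\<omega>\<in>space P. sample_mean Z h n \<omega> \<ge> c} \<subseteq> ?A \<union> ?B"
    proof (intro subsetI)
      fix \<omega> assume "\<omega> \<in> {\<omega>\<in>space P. sample_mean Z h n \<omega> \<ge> c}"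
      then have "\<omega> \<in> space P" "c \<le> sample_mean Z (low m) n \<omega> + sample_mean Z (tail m) n \<omega>"
        by (auto simp: split)
      then show "\<omega> \<in> ?A \<union> ?B"
        using le by (cases "sample_mean Z (tail m) n \<omega> \<ge> s") auto
    qed
    then have "prob {\<omega>\<in>space P. sample_mean Z h n \<omega> \<ge> c} \<le> prob (?A \<union> ?B)"
      by (intro finite_measure_mono) auto
    also have "\<dots> \<le> prob ?A + prob ?B" by (intro measure_Un_le) auto
    also have "prob ?B \<le> expectation (\<lambda>\<omega>. tail m (Z 0 \<omega>)) / s"
      using tail int_tail s n by (intro sample_mean_Markov) auto
    also have "\<dots> < \<epsilon> / 2" using m s by (simp add: field_simps)
    also have "prob ?A < \<epsilon> / 2" using N n by auto
    finally show ?thesis by simp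
  qed
  then show "\<exists>N. \<forall>n\<ge>N. norm (prob {\<omega>\<in>space P. sample_mean Z h n \<omega> \<ge> c} - 0) < \<epsilon>"
    by (intro exI[of _ "max 1 N"]) auto
qed

end

section \<open>Envelopes of the loss along a tube around a curve\<close>

text \<open>
  Bounds for the loss over all curves in the tube of radius \<open>\<eta>\<close> around \<open>x\<close>.  The shifts are restricted
  to rational numbers to make the envelopes measurable; by continuity of the loss they bound it for
  all real shifts.
\<close>

definition lower_env :: "(real \<Rightarrow> real \<Rightarrow> real) \<Rightarrow> real \<Rightarrow> (real \<Rightarrow> real) \<Rightarrow> real \<times> real \<Rightarrow> real" where
  "lower_env g \<eta> x = (\<lambda>(y, t). INF h\<in>{-\<eta><..<\<eta>} \<inter> \<rat>. g y (x t + h))"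

definition upper_env :: "(real \<Rightarrow> real \<Rightarrow> real) \<Rightarrow> real \<Rightarrow> (real \<Rightarrow> real) \<Rightarrow> real \<times> real \<Rightarrow> real" where
  "upper_env g \<eta> x = (\<lambda>(y, t). SUP h\<in>{-\<eta><..<\<eta>} \<inter> \<rat>. g y (x t + h))"

lemma zero_in_window: "\<eta> > 0 \<Longrightarrow> (0::real) \<in> {-\<eta><..<\<eta>} \<inter> \<rat>"
  by auto

context
  fixes g :: "real \<Rightarrow> real \<Rightarrow> real"
  assumes g_cont: "continuous_on UNIV (\<lambda>(y, x). g y x)"
begin

lemma continuous_on_loss_shift: "continuous_on S (\<lambda>h. g y (a + h))"
proof -
  have "continuous_on S ((\<lambda>(y, x). g y x) \<circ> (\<lambda>h. (y, a + h)))"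
    by (intro continuous_on_compose continuous_on_subset[OF g_cont] continuous_intros) auto
  then show ?thesis by (simp add: comp_def)
qed

lemma loss_shift_bdd: "bdd_below ((\<lambda>h. g y (a + h)) ` ({-\<eta><..<\<eta>} \<inter> \<rat>))"
  "bdd_above ((\<lambda>h. g y (a + h)) ` ({-\<eta><..<\<eta>} \<inter> \<rat>))"
proof -
  have "bounded ((\<lambda>h. g y (a + h)) ` {-\<eta>..\<eta>})"
    by (intro compact_imp_bounded compact_continuous_image continuous_on_loss_shift) auto
  then have "bounded ((\<lambda>h. g y (a + h)) ` ({-\<eta><..<\<eta>} \<inter> \<rat>))"
    by (rule bounded_subset) auto
  then show "bdd_below ((\<lambda>h. g y (a + h)) ` ({-\<eta><..<\<eta>} \<inter> \<rat>))"
    "bdd_above ((\<lambda>h. g y (a + h)) ` ({-\<eta><..<\<eta>} \<inter> \<rat>))"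
    by (auto intro: bounded_imp_bdd_below bounded_imp_bdd_above)
qed

lemma envelope_bounds:
  assumes x': "\<bar>x' - x t\<bar> < \<eta>"
  shows "lower_env g \<eta> x (y, t) \<le> g y x'" "g y x' \<le> upper_env g \<eta> x (y, t)"
proof -
  let ?W = "{-\<eta><..<\<eta>} \<inter> \<rat>" and ?f = "\<lambda>h. g y (x t + h)"
  have "closure ({-\<eta><..<\<eta>} \<inter> (\<rat>::real set)) = closure {-\<eta><..<\<eta>}"
    by (intro closure_open_Int_superset) (auto simp: Rats_closure_real)
  then have mem: "x' - x t \<in> closure ?W"
    using x' closure_subset[of "{-\<eta><..<\<eta>}"] by (auto simp: abs_less_iff)
  have "?f (x' - x t) \<in> {lower_env g \<eta> x (y, t)..upper_env g \<eta> x (y, t)}"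
  proof (rule set_mp[OF image_closure_subset imageI[OF mem]])
    show "continuous_on (closure ?W) ?f" by (rule continuous_on_loss_shift)
    show "?f ` ?W \<subseteq> {lower_env g \<eta> x (y, t)..upper_env g \<eta> x (y, t)}"
    proof (intro image_subsetI)
      fix h assume "h \<in> ?W"
      from cINF_lower[OF loss_shift_bdd(1) this, of y "x t"] cSUP_upper[OF this loss_shift_bdd(2), of y "x t"]
      show "?f h \<in> {lower_env g \<eta> x (y, t)..upper_env g \<eta> x (y, t)}"
        by (simp add: lower_env_def upper_env_def)
    qed
  qed auto
  then show "lower_env g \<eta> x (y, t) \<le> g y x'" "g y x' \<le> upper_env g \<eta> x (y, t)" by auto
qed

lemma envelope_within:
  assumes \<eta>: "\<eta> > 0" and B: "\<And>h. \<bar>h\<bar> < \<eta> \<Longrightarrow> g y (x t + h) \<in> {l..u}"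
  shows "l \<le> lower_env g \<eta> x (y, t)" "upper_env g \<eta> x (y, t) \<le> u"
proof -
  have "g y (x t + h) \<in> {l..u}" if "h \<in> {-\<eta><..<\<eta>} \<inter> \<rat>" for h
    using that by (intro B) auto
  moreover have "{-\<eta><..<\<eta>} \<inter> \<rat> \<noteq> {}" using zero_in_window[OF \<eta>] by blast
  ultimately have "l \<le> (INF h\<in>{-\<eta><..<\<eta>} \<inter> \<rat>. g y (x t + h)) \<and>
      (SUP h\<in>{-\<eta><..<\<eta>} \<inter> \<rat>. g y (x t + h)) \<le> u"
    by (intro conjI cINF_greatest cSUP_least) auto
  then show "l \<le> lower_env g \<eta> x (y, t)" "upper_env g \<eta> x (y, t) \<le> u"
    by (simp_all add: lower_env_def upper_env_def)
qed

lemma envelope_tendsto: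
  "(\<lambda>k. lower_env g (1 / Suc k) x (y, t)) \<longlonglongrightarrow> g y (x t)"
  "(\<lambda>k. upper_env g (1 / Suc k) x (y, t)) \<longlonglongrightarrow> g y (x t)"
proof -
  have *: "\<forall>\<^sub>F k in sequentially. dist (lower_env g (1 / Suc k) x (y, t)) (g y (x t)) < \<epsilon> \<and>
          dist (upper_env g (1 / Suc k) x (y, t)) (g y (x t)) < \<epsilon>" if \<epsilon>: "\<epsilon> > 0" for \<epsilon>
  proof -
    have "\<exists>d>0. \<forall>h\<in>UNIV. dist h 0 < d \<longrightarrow> dist (g y (x t + h)) (g y (x t + 0)) < \<epsilon> / 2"
      using continuous_on_loss_shift[of UNIV y "x t"] half_gt_zero[OF \<epsilon>]
      unfolding continuous_on_iff by blast
    then obtain d where d: "d > 0" "\<And>h. \<bar>h\<bar> < d \<Longrightarrow> \<bar>g y (x t + h) - g y (x t)\<bar> < \<epsilon> / 2"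
      by (auto simp: dist_real_def)
    have "(\<lambda>k. 1 / real (Suc k)) \<longlonglongrightarrow> 0" using LIMSEQ_Suc[OF lim_1_over_n] by simp
    then have "\<forall>\<^sub>F k in sequentially. 1 / real (Suc k) < d" using d(1) by (rule order_tendstoD)
    then show ?thesis
    proof eventually_elim
      case (elim k)
      have p: "1 / real (Suc k) > 0" by simp
      have "g y (x t + h) \<in> {g y (x t) - \<epsilon> / 2..g y (x t) + \<epsilon> / 2}" if h: "\<bar>h\<bar> < 1 / real (Suc k)" for h
      proof -
        from d(2)[OF less_trans[OF h elim]] show ?thesis
          unfolding abs_less_iff atLeastAtMost_iff by linarith
      qed
      note w = envelope_within[of "1 / real (Suc k)" y x t, OF p this]
      have "\<bar>x t - x t\<bar> < 1 / real (Suc k)" by simp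
      note b = envelope_bounds[of "x t" x t "1 / real (Suc k)" y, OF this]
      show ?case unfolding dist_real_def abs_less_iff using w b \<epsilon> by linarith
    qed
  qed
  show "(\<lambda>k. lower_env g (1 / Suc k) x (y, t)) \<longlonglongrightarrow> g y (x t)"
    "(\<lambda>k. upper_env g (1 / Suc k) x (y, t)) \<longlonglongrightarrow> g y (x t)"
    by (rule tendstoI, rule eventually_mono[OF *], assumption, blast)+
qed

lemma envelope_measurable:
  assumes x: "continuous_on UNIV x"
  shows "lower_env g \<eta> x \<in> borel_measurable borel" "upper_env g \<eta> x \<in> borel_measurable borel"
proof -
  have c: "countable ({-\<eta><..<\<eta>} \<inter> \<rat>)" by (simp add: countable_rat countable_Int2)
  have m: "(\<lambda>z. g (fst z) (x (snd z) + h)) \<in> borel_measurable borel" for h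
  proof (rule borel_measurable_continuous_onI)
    have "continuous_on UNIV ((\<lambda>(y, x). g y x) \<circ> (\<lambda>z. (fst z, x (snd z) + h)))"
      by (intro continuous_on_compose continuous_on_subset[OF g_cont] continuous_intros
          continuous_on_compose2[OF x]) auto
    then show "continuous_on UNIV (\<lambda>z. g (fst z) (x (snd z) + h))" by (simp add: comp_def)
  qed
  show "lower_env g \<eta> x \<in> borel_measurable borel"
    unfolding lower_env_def case_prod_beta
    by (intro borel_measurable_cINF c m loss_shift_bdd)
  show "upper_env g \<eta> x \<in> borel_measurable borel"
    unfolding upper_env_def case_prod_beta
    by (intro borel_measurable_cSUP c m loss_shift_bdd)
qed

end

section \<open>The growth condition as a Harnack-type inequality\<close>

text \<open>
  A positive lower limit of the quotient of infimum and supremum compares, for all large \<open>\<bar>y\<bar>\<close>, any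
  two values on \<open>\<Lambda>\<close>.
\<close>

lemma growth_cond_imp_comparable:
  fixes h :: "real \<Rightarrow> real \<Rightarrow> real"
  assumes "growth_cond h \<Lambda>"
  shows "\<exists>b. \<exists>C\<ge>0. \<forall>y x x'. b \<le> \<bar>y\<bar> \<longrightarrow> x \<in> \<Lambda> \<longrightarrow> x' \<in> \<Lambda> \<longrightarrow> \<bar>h y x\<bar> \<le> C * (1 + \<bar>h y x'\<bar>)"
proof -
  let ?I = "\<lambda>y. INF x\<in>\<Lambda>. ennreal \<bar>h y x\<bar>" and ?S = "\<lambda>y. SUP x\<in>\<Lambda>. ennreal \<bar>h y x\<bar>"
  obtain e where e: "0 < e" "e < Liminf at_infinity (\<lambda>y. (1 + ?I y) / ?S y)"
    using assms dense unfolding growth_cond_def by blast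
  then obtain c where c: "e = ennreal c" "c \<ge> 0" by (cases e) auto
  have c0: "c > 0" using e c by simp
  have "\<forall>\<^sub>F y in at_infinity. e < (1 + ?I y) / ?S y" by (rule less_LiminfD[OF e(2)])
  then obtain b where b: "\<And>y. b \<le> \<bar>y\<bar> \<Longrightarrow> e < (1 + ?I y) / ?S y"
    by (auto simp: eventually_at_infinity)
  show ?thesis
  proof (rule exI[of _ b], rule exI[of _ "1 / c"], intro conjI allI impI)
    show "1 / c \<ge> 0" using c0 by simp
    fix y x x' assume y: "b \<le> \<bar>y\<bar>" and x: "x \<in> \<Lambda>" "x' \<in> \<Lambda>"
    have S: "ennreal \<bar>h y x\<bar> \<le> ?S y" and I: "?I y \<le> ennreal \<bar>h y x'\<bar>"
      using x by (auto intro: SUP_upper INF_lower)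
    have "?S y \<noteq> top"
    proof
      assume eq: "?S y = top"
      show False using b[OF y] unfolding eq by simp
    qed
    show "\<bar>h y x\<bar> \<le> 1 / c * (1 + \<bar>h y x'\<bar>)"
    proof (cases "?S y = 0")
      case True
      then have "h y x = 0" using S by simp
      then show ?thesis using c0 by simp
    next
      case False
      have "ennreal (c * \<bar>h y x\<bar>) = e * ennreal \<bar>h y x\<bar>" using c by (simp add: ennreal_mult)
      also have "\<dots> \<le> (1 + ?I y) / ?S y * ?S y" using b[OF y] S by (intro mult_mono) auto
      also have "\<dots> = 1 + ?I y"
        using mult_divide_eq_ennreal[OF False \<open>?S y \<noteq> top\<close>]
        by (metis ennreal_divide_times ennreal_times_divide mult.commute)
      also have "\<dots> \<le> 1 + ennreal \<bar>h y x'\<bar>" using I by (intro add_left_mono)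
      also have "\<dots> = ennreal (1 + \<bar>h y x'\<bar>)" by simp
      finally have "c * \<bar>h y x\<bar> \<le> 1 + \<bar>h y x'\<bar>" by (subst (asm) ennreal_le_iff) auto
      then show ?thesis using c0 by (simp add: field_simps)
    qed
  qed
qed

text \<open>
  The additive 1 makes the comparison trivial on bounded sets of \<open>y\<close>, where the loss is bounded; the
  growth condition supplies it for the remaining values.  It turns integrability of the loss along
  one bounded curve into integrability of its supremum over bounded sets.
\<close>

lemma loss_comparable_AE:
  fixes g :: "real \<Rightarrow> real \<Rightarrow> real"
  assumes g_cont: "continuous_on UNIV (\<lambda>(y, x). g y x)" and nonneg: "\<And>y x. g y x \<ge> 0"
    and growth: "\<not> (\<exists>b. AE \<omega> in P. \<bar>Y \<omega>\<bar> \<le> b) \<Longrightarrow> growth_cond g \<Lambda>"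
    and \<Lambda>: "compact \<Lambda>"
  obtains C where "C \<ge> 0" "AE \<omega> in P. \<forall>x\<in>\<Lambda>. \<forall>x'\<in>\<Lambda>. g (Y \<omega>) x \<le> C * (1 + g (Y \<omega>) x')"
proof -
  have bounded_range: "\<exists>M\<ge>0. \<forall>y x x'. \<bar>y\<bar> \<le> b \<longrightarrow> x \<in> \<Lambda> \<longrightarrow> g y x \<le> M * (1 + g y x')" for b
  proof -
    have "bounded ((\<lambda>(y, x). g y x) ` ({-b..b} \<times> \<Lambda>))"
      using \<Lambda> by (intro compact_imp_bounded compact_continuous_image continuous_on_subset[OF g_cont]
          compact_Times) auto
    then obtain M where M: "M > 0" "\<And>y x. y \<in> {-b..b} \<Longrightarrow> x \<in> \<Lambda> \<Longrightarrow> \<bar>g y x\<bar> \<le> M"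
      by (auto simp: bounded_pos)
    have "g y x \<le> M * (1 + g y x')" if "\<bar>y\<bar> \<le> b" "x \<in> \<Lambda>" for y x x'
    proof -
      have "g y x \<le> M * 1" using M(2)[of y x] that by (auto simp: abs_le_iff)
      also have "\<dots> \<le> M * (1 + g y x')" using M(1) nonneg by (intro mult_left_mono) auto
      finally show ?thesis .
    qed
    then show ?thesis using M(1) by (intro exI[of _ M]) auto
  qed
  show ?thesis
  proof (cases "\<exists>b. AE \<omega> in P. \<bar>Y \<omega>\<bar> \<le> b")
    case True
    then obtain b where b: "AE \<omega> in P. \<bar>Y \<omega>\<bar> \<le> b" by blast
    obtain M where M: "M \<ge> 0" "\<And>y x x'. \<bar>y\<bar> \<le> b \<Longrightarrow> x \<in> \<Lambda> \<Longrightarrow> g y x \<le> M * (1 + g y x')"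
      using bounded_range[of b] by blast
    show ?thesis by (rule that[OF M(1)]) (use b M(2) in auto)
  next
    case False
    obtain b C where C: "C \<ge> 0"
      "\<forall>y x x'. b \<le> \<bar>y\<bar> \<longrightarrow> x \<in> \<Lambda> \<longrightarrow> x' \<in> \<Lambda> \<longrightarrow> \<bar>g y x\<bar> \<le> C * (1 + \<bar>g y x'\<bar>)"
      using growth_cond_imp_comparable[OF growth[OF False]] by blast
    obtain M where M: "M \<ge> 0" "\<And>y x x'. \<bar>y\<bar> \<le> b \<Longrightarrow> x \<in> \<Lambda> \<Longrightarrow> g y x \<le> M * (1 + g y x')"
      using bounded_range[of b] by blast
    have "g y x \<le> max C M * (1 + g y x')" if x: "x \<in> \<Lambda>" "x' \<in> \<Lambda>" for y x x'
    proof -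
      have "g y x \<le> C * (1 + g y x') \<or> g y x \<le> M * (1 + g y x')"
        using C(2)[rule_format, of y x x'] M(2)[of y x x'] x nonneg by (cases "\<bar>y\<bar> \<le> b") auto
      moreover have "C * (1 + g y x') \<le> max C M * (1 + g y x')"
        "M * (1 + g y x') \<le> max C M * (1 + g y x')"
        using nonneg[of y x'] by (auto intro!: mult_right_mono)
      ultimately show ?thesis by linarith
    qed
    then show ?thesis using C(1) by (intro that[of "max C M"]) auto
  qed
qed

section \<open>Expectations of the envelopes\<close>

lemma lower_env_nonneg:
  assumes nonneg: "\<And>y x. g y x \<ge> 0" and \<eta>: "\<eta> > 0"
  shows "0 \<le> lower_env g \<eta> x z"
proof -
  obtain y t where z: "z = (y, t)" by (cases z)
  have "{-\<eta><..<\<eta>} \<inter> \<rat> \<noteq> {}" using zero_in_window[OF \<eta>] by blast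
  then have "0 \<le> (INF h\<in>{-\<eta><..<\<eta>} \<inter> \<rat>. g y (x t + h))"
    by (rule cINF_greatest) (rule nonneg)
  then show ?thesis by (simp add: lower_env_def z)
qed

context iid_sample
begin

text \<open>
  The curve \<open>x0\<close>, along which the loss is integrable, serves as the reference of the comparison
  inequality on a compact set that contains \<open>x0\<close> and the whole tube around \<open>x\<close>.
\<close>

lemma integrable_upper_env:
  assumes g_cont: "continuous_on UNIV (\<lambda>(y, x). g y x)" and nonneg: "\<And>y x. g y x \<ge> 0"
    and growth: "\<not> (\<exists>b. AE \<omega> in P. \<bar>fst (Z 0 \<omega>)\<bar> \<le> b) \<Longrightarrow> \<forall>\<Lambda>. compact \<Lambda> \<longrightarrow> growth_cond g \<Lambda>"
    and x: "continuous_on UNIV x" "\<And>t. \<bar>x t\<bar> \<le> R"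
    and x0: "\<And>t. \<bar>x0 t\<bar> \<le> R0" "integrable P (\<lambda>\<omega>. g (fst (Z 0 \<omega>)) (x0 (snd (Z 0 \<omega>))))"
    and \<eta>: "\<eta> > 0"
  shows "integrable P (\<lambda>\<omega>. upper_env g \<eta> x (Z 0 \<omega>))"
proof -
  define \<Lambda> where "\<Lambda> = {-(R + R0 + \<eta>)..R + R0 + \<eta>}"
  have R: "0 \<le> R" "0 \<le> R0" using x(2)[of 0] x0(1)[of 0] by linarith+
  have \<Lambda>: "compact \<Lambda>" by (simp add: \<Lambda>_def)
  obtain C where C: "C \<ge> 0"
    "AE \<omega> in P. \<forall>x\<in>\<Lambda>. \<forall>x'\<in>\<Lambda>. g (fst (Z 0 \<omega>)) x \<le> C * (1 + g (fst (Z 0 \<omega>)) x')"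
    using loss_comparable_AE[where P = P and Y = "\<lambda>\<omega>. fst (Z 0 \<omega>)", OF g_cont nonneg _ \<Lambda>]
      growth \<Lambda> by blast
  have "integrable P (\<lambda>\<omega>. C * (1 + g (fst (Z 0 \<omega>)) (x0 (snd (Z 0 \<omega>)))))"
    using x0(2) by auto
  then show ?thesis
  proof (rule Bochner_Integration.integrable_bound)
    show "(\<lambda>\<omega>. upper_env g \<eta> x (Z 0 \<omega>)) \<in> borel_measurable P"
      by (rule measurable_compose[OF Z_measurable envelope_measurable(2)[OF g_cont x(1)]])
    show "AE \<omega> in P. norm (upper_env g \<eta> x (Z 0 \<omega>)) \<le> norm (C * (1 + g (fst (Z 0 \<omega>)) (x0 (snd (Z 0 \<omega>)))))"
      using C(2)
    proof eventually_elim
      case (elim \<omega>)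
      obtain y t where Z: "Z 0 \<omega> = (y, t)" by (cases "Z 0 \<omega>")
      have "x0 t \<in> \<Lambda>" using x0(1)[of t] R \<eta> by (auto simp: \<Lambda>_def abs_le_iff)
      moreover have "x t + h \<in> \<Lambda>" if "\<bar>h\<bar> < \<eta>" for h
        using x(2)[of t] R that by (auto simp: \<Lambda>_def abs_le_iff abs_less_iff)
      ultimately have "g y (x t + h) \<in> {0..C * (1 + g y (x0 t))}" if "\<bar>h\<bar> < \<eta>" for h
        using elim nonneg that by (simp add: Z)
      then have "upper_env g \<eta> x (y, t) \<le> C * (1 + g y (x0 t))"
        by (rule envelope_within(2)[OF g_cont \<eta>])
      moreover have "0 \<le> upper_env g \<eta> x (y, t)"
        using envelope_bounds(2)[OF g_cont, of "x t" x t \<eta> y] nonneg[of y "x t"] \<eta> by simp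
      ultimately show ?case by (simp add: Z)
    qed
  qed
qed

text \<open>
  By Fatou's lemma along envelopes of radius \<open>1 / Suc k\<close> that are truncated at \<open>k\<close>.  The expected
  loss on the right may be infinite; the truncation makes the function bounded, so that the law of
  large numbers applies to it.
\<close>

lemma lower_env_expectation_gt:
  assumes g_cont: "continuous_on UNIV (\<lambda>(y, x). g y x)" and nonneg: "\<And>y x. g y x \<ge> 0"
    and x: "continuous_on UNIV x"
    and c: "ennreal c < (\<integral>\<^sup>+\<omega>. ennreal (g (fst (Z 0 \<omega>)) (x (snd (Z 0 \<omega>)))) \<partial>P)"
  shows "\<exists>\<eta>>0. \<exists>m\<ge>0. c < expectation (\<lambda>\<omega>. min m (lower_env g \<eta> x (Z 0 \<omega>)))"
proof -
  define \<phi> where "\<phi> k \<omega> = min (real k) (lower_env g (1 / Suc k) x (Z 0 \<omega>))" for k \<omega>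
  have [measurable]: "\<phi> k \<in> borel_measurable P" for k
  proof -
    have "(\<lambda>\<omega>. lower_env g (1 / Suc k) x (Z 0 \<omega>)) \<in> borel_measurable P"
      by (rule measurable_compose[OF Z_measurable envelope_measurable(1)[OF g_cont x]])
    then show ?thesis unfolding \<phi>_def[abs_def] by measurable
  qed
  have env0: "0 \<le> lower_env g (1 / Suc k) x z" for k z
    by (rule lower_env_nonneg) (simp_all add: nonneg)
  have \<phi>0: "0 \<le> \<phi> k \<omega>" "\<phi> k \<omega> \<le> k" for k \<omega> using env0 by (auto simp: \<phi>_def)
  have lim: "(\<lambda>k. \<phi> k \<omega>) \<longlonglongrightarrow> g (fst (Z 0 \<omega>)) (x (snd (Z 0 \<omega>)))" for \<omega>
  proof -
    obtain y t where Z: "Z 0 \<omega> = (y, t)" by (cases "Z 0 \<omega>")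
    have env: "(\<lambda>k. lower_env g (1 / Suc k) x (y, t)) \<longlonglongrightarrow> g y (x t)"
      by (rule envelope_tendsto(1)[OF g_cont])
    obtain M :: nat where M: "g y (x t) < M" using reals_Archimedean2 by blast
    have "\<forall>\<^sub>F k in sequentially. lower_env g (1 / Suc k) x (y, t) < M"
      using env M by (rule order_tendstoD)
    moreover have "\<forall>\<^sub>F k in sequentially. k \<ge> M" by (rule eventually_ge_at_top)
    ultimately have "\<forall>\<^sub>F k in sequentially. lower_env g (1 / Suc k) x (y, t) = \<phi> k \<omega>"
      by eventually_elim (auto simp: \<phi>_def Z)
    from Lim_transform_eventually[OF env this] show ?thesis by (simp add: Z)
  qed
  have "(\<integral>\<^sup>+\<omega>. ennreal (g (fst (Z 0 \<omega>)) (x (snd (Z 0 \<omega>)))) \<partial>P) =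
        (\<integral>\<^sup>+\<omega>. liminf (\<lambda>k. ennreal (\<phi> k \<omega>)) \<partial>P)"
    by (intro nn_integral_cong lim_imp_Liminf[symmetric] tendsto_ennrealI lim) simp
  also have "\<dots> \<le> liminf (\<lambda>k. \<integral>\<^sup>+\<omega>. ennreal (\<phi> k \<omega>) \<partial>P)"
    by (rule nn_integral_liminf) measurable
  finally have "\<forall>\<^sub>F k in sequentially. ennreal c < (\<integral>\<^sup>+\<omega>. ennreal (\<phi> k \<omega>) \<partial>P)"
    using c by (intro less_LiminfD) (auto intro: less_le_trans)
  then obtain k where k: "ennreal c < (\<integral>\<^sup>+\<omega>. ennreal (\<phi> k \<omega>) \<partial>P)"
    by (auto simp: eventually_sequentially)
  have "integrable P (\<phi> k)"
    using \<phi>0 by (intro integrable_const_bound[of _ "real k"]) auto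
  then have "(\<integral>\<^sup>+\<omega>. ennreal (\<phi> k \<omega>) \<partial>P) = ennreal (expectation (\<phi> k))"
    using \<phi>0 by (intro nn_integral_eq_integral) auto
  then have "c < expectation (\<phi> k)"
    using k by (metis ennreal_leI not_less)
  then show ?thesis
    by (intro exI[of _ "1 / Suc k"] conjI exI[of _ "real k"]) (auto simp: \<phi>_def[abs_def])
qed

lemma upper_env_expectation_less:
  assumes g_cont: "continuous_on UNIV (\<lambda>(y, x). g y x)" and nonneg: "\<And>y x. g y x \<ge> 0"
    and x: "continuous_on UNIV x"
    and int: "\<And>\<eta>. \<eta> > 0 \<Longrightarrow> integrable P (\<lambda>\<omega>. upper_env g \<eta> x (Z 0 \<omega>))"
    and c: "expectation (\<lambda>\<omega>. g (fst (Z 0 \<omega>)) (x (snd (Z 0 \<omega>)))) < c"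
  shows "\<exists>\<eta>>0. expectation (\<lambda>\<omega>. upper_env g \<eta> x (Z 0 \<omega>)) < c"
proof -
  have meas: "(\<lambda>\<omega>. upper_env g \<eta> x (Z 0 \<omega>)) \<in> borel_measurable P" for \<eta>
    by (rule measurable_compose[OF Z_measurable envelope_measurable(2)[OF g_cont x]])
  have "(\<lambda>z. g (fst z) (x (snd z))) \<in> borel_measurable borel"
  proof (rule borel_measurable_continuous_onI)
    have "continuous_on UNIV ((\<lambda>(y, x). g y x) \<circ> (\<lambda>z. (fst z, x (snd z))))"
      by (intro continuous_on_compose continuous_on_subset[OF g_cont] continuous_intros
          continuous_on_compose2[OF x]) auto
    then show "continuous_on UNIV (\<lambda>z. g (fst z) (x (snd z)))" by (simp add: comp_def)
  qed
  then have meas': "(\<lambda>\<omega>. g (fst (Z 0 \<omega>)) (x (snd (Z 0 \<omega>)))) \<in> borel_measurable P"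
    by (rule measurable_compose[OF Z_measurable])
  have "(\<lambda>k. expectation (\<lambda>\<omega>. upper_env g (1 / Suc k) x (Z 0 \<omega>))) \<longlonglongrightarrow>
        expectation (\<lambda>\<omega>. g (fst (Z 0 \<omega>)) (x (snd (Z 0 \<omega>))))"
  proof (rule integral_dominated_convergence[OF meas' meas int[OF zero_less_one]])
    show "AE \<omega> in P. (\<lambda>k. upper_env g (1 / Suc k) x (Z 0 \<omega>)) \<longlonglongrightarrow> g (fst (Z 0 \<omega>)) (x (snd (Z 0 \<omega>)))"
    proof (rule AE_I2)
      fix \<omega>
      show "(\<lambda>k. upper_env g (1 / Suc k) x (Z 0 \<omega>)) \<longlonglongrightarrow> g (fst (Z 0 \<omega>)) (x (snd (Z 0 \<omega>)))"
        using envelope_tendsto(2)[OF g_cont, of x "fst (Z 0 \<omega>)" "snd (Z 0 \<omega>)"] by simp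
    qed
    show "AE \<omega> in P. norm (upper_env g (1 / Suc k) x (Z 0 \<omega>)) \<le> upper_env g 1 x (Z 0 \<omega>)" for k
    proof (rule AE_I2)
      fix \<omega>
      obtain y t where Z: "Z 0 \<omega> = (y, t)" by (cases "Z 0 \<omega>")
      have k: "0 < 1 / real (Suc k)" "1 / real (Suc k) \<le> 1" by auto
      have "g y (x t + h) \<in> {0..upper_env g 1 x (y, t)}" if "\<bar>h\<bar> < 1 / real (Suc k)" for h
        using envelope_bounds(2)[OF g_cont, of "x t + h" x t 1 y] nonneg that k(2) by auto
      then have "upper_env g (1 / real (Suc k)) x (y, t) \<le> upper_env g 1 x (y, t)"
        by (rule envelope_within(2)[OF g_cont k(1)])
      moreover have "0 \<le> upper_env g (1 / real (Suc k)) x (y, t)"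
        using envelope_bounds(2)[OF g_cont, of "x t" x t "1 / real (Suc k)" y] nonneg[of y "x t"] k(1)
        by simp
      ultimately show "norm (upper_env g (1 / Suc k) x (Z 0 \<omega>)) \<le> upper_env g 1 x (Z 0 \<omega>)"
        by (simp add: Z)
    qed
  qed
  then have "\<forall>\<^sub>F k in sequentially. expectation (\<lambda>\<omega>. upper_env g (1 / Suc k) x (Z 0 \<omega>)) < c"
    using c by (rule order_tendstoD)
  then obtain k where "expectation (\<lambda>\<omega>. upper_env g (1 / Suc k) x (Z 0 \<omega>)) < c"
    by (auto simp: eventually_sequentially)
  then show ?thesis by (intro exI[of _ "1 / Suc k"]) auto
qed

end

section \<open>Convergence in probability from local exclusion\<close>

text \<open>
  Tightness confines the variables to a compact set up to small probability, and the part of that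
  set outside a ball around \<open>c\<close> is covered by finitely many excluded neighbourhoods.
\<close>

lemma (in prob_space) tendsto_in_prob_if_locally_excluded:
  fixes X :: "nat \<Rightarrow> 'a \<Rightarrow> 's::metric_space"
  assumes X: "\<And>n. n \<ge> 1 \<Longrightarrow> X n \<in> borel_measurable M"
    and tight: "uniformly_tight M S X"
    and excl: "\<And>s. s \<in> S \<Longrightarrow> s \<noteq> c \<Longrightarrow>
        \<exists>N. open N \<and> s \<in> N \<and> (\<lambda>n. prob {\<omega>\<in>space M. X n \<omega> \<in> N}) \<longlonglongrightarrow> 0"
  shows "tendsto_in_prob M X c"
  unfolding tendsto_in_prob_def
proof (intro allI impI LIMSEQ_I)
  fix \<epsilon> e :: real assume \<epsilon>: "\<epsilon> > 0" and e: "e > 0"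
  obtain K where K: "compact K" "K \<subseteq> S" "(SUP n\<in>{1..}. prob {\<omega>\<in>space M. X n \<omega> \<notin> K}) < e / 2"
    using tight e unfolding uniformly_tight_def by (meson half_gt_zero)
  have out: "prob {\<omega>\<in>space M. X n \<omega> \<notin> K} < e / 2" if "n \<ge> 1" for n
  proof -
    have "prob {\<omega>\<in>space M. X n \<omega> \<notin> K} \<le> (SUP n\<in>{1..}. prob {\<omega>\<in>space M. X n \<omega> \<notin> K})"
      using that by (intro cSUP_upper) (auto intro!: bdd_aboveI[of _ 1])
    then show ?thesis using K(3) by simp
  qed
  define K' where "K' = K - ball c \<epsilon>"
  have K': "compact K'" using K(1) unfolding K'_def by (intro compact_diff) auto
  have "\<forall>s\<in>K'. \<exists>N. open N \<and> s \<in> N \<and> (\<lambda>n. prob {\<omega>\<in>space M. X n \<omega> \<in> N}) \<longlonglongrightarrow> 0"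
    using K(2) \<epsilon> by (intro ballI excl) (auto simp: K'_def)
  from bchoice[OF this] obtain N where N: "\<And>s. s \<in> K' \<Longrightarrow> open (N s)" "\<And>s. s \<in> K' \<Longrightarrow> s \<in> N s"
    "\<And>s. s \<in> K' \<Longrightarrow> (\<lambda>n. prob {\<omega>\<in>space M. X n \<omega> \<in> N s}) \<longlonglongrightarrow> 0"
    by blast
  obtain I where I: "I \<subseteq> K'" "finite I" "K' \<subseteq> (\<Union>s\<in>I. N s)"
  proof (rule compactE_image[of K' K' N])
    show "compact K'" by (rule K')
    show "open (N s)" if "s \<in> K'" for s by (rule N(1)[OF that])
    show "K' \<subseteq> (\<Union>s\<in>K'. N s)" using N(2) by blast
  qed (rule that)
  have "(\<lambda>n. \<Sum>s\<in>I. prob {\<omega>\<in>space M. X n \<omega> \<in> N s}) \<longlonglongrightarrow> (\<Sum>s\<in>I. 0)"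
    using I(1) N(3) by (intro tendsto_sum) auto
  then have "\<forall>\<^sub>F n in sequentially. (\<Sum>s\<in>I. prob {\<omega>\<in>space M. X n \<omega> \<in> N s}) < e / 2"
    using e by (intro order_tendstoD) auto
  moreover have "\<forall>\<^sub>F n in sequentially. n \<ge> (1::nat)" by (rule eventually_ge_at_top)
  ultimately have "\<forall>\<^sub>F n in sequentially. prob {\<omega>\<in>space M. dist (X n \<omega>) c > \<epsilon>} < e"
  proof eventually_elim
    case (elim n)
    note [measurable] = X[OF elim(2)]
    have [measurable]: "K \<in> sets borel" using K(1) by (intro borel_closed compact_imp_closed)
    have [measurable]: "{\<omega>\<in>space M. X n \<omega> \<in> N s} \<in> sets M" if "s \<in> I" for s
    proof -
      have [measurable]: "N s \<in> sets borel" using N(1) that I(1) by (intro borel_open) auto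
      show ?thesis by measurable
    qed
    have out_set: "{\<omega>\<in>space M. X n \<omega> \<notin> K} \<in> sets M" by measurable
    have un: "(\<Union>s\<in>I. {\<omega>\<in>space M. X n \<omega> \<in> N s}) \<in> sets M"
      using I(2) by (intro sets.finite_UN) auto
    have "{\<omega>\<in>space M. dist (X n \<omega>) c > \<epsilon>} \<subseteq>
        {\<omega>\<in>space M. X n \<omega> \<notin> K} \<union> (\<Union>s\<in>I. {\<omega>\<in>space M. X n \<omega> \<in> N s})"
      using I(3) by (auto simp: K'_def dist_commute)
    then have "prob {\<omega>\<in>space M. dist (X n \<omega>) c > \<epsilon>} \<le>
        prob ({\<omega>\<in>space M. X n \<omega> \<notin> K} \<union> (\<Union>s\<in>I. {\<omega>\<in>space M. X n \<omega> \<in> N s}))"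
      using out_set un by (intro finite_measure_mono) auto
    also have "\<dots> \<le> prob {\<omega>\<in>space M. X n \<omega> \<notin> K} + prob (\<Union>s\<in>I. {\<omega>\<in>space M. X n \<omega> \<in> N s})"
      by (intro measure_Un_le out_set un)
    also have "prob (\<Union>s\<in>I. {\<omega>\<in>space M. X n \<omega> \<in> N s}) \<le> (\<Sum>s\<in>I. prob {\<omega>\<in>space M. X n \<omega> \<in> N s})"
      using I(2) by (intro measure_UNION_le) auto
    also have "\<dots> < e / 2" by (rule elim(1))
    also have "prob {\<omega>\<in>space M. X n \<omega> \<notin> K} < e / 2" by (rule out[OF elim(2)])
    finally show ?case by simp
  qed
  then show "\<exists>n0. \<forall>n\<ge>n0. norm (prob {\<omega>\<in>space M. dist (X n \<omega>) c > \<epsilon>} - 0) < e"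
    by (simp add: eventually_sequentially)
qed

section \<open>Local exclusion of wrong parameters\<close>

lemma Hn_eq_sample_mean:
  "Hn g Y \<tau> n \<omega> f = - sample_mean (\<lambda>i \<omega>. (Y i \<omega>, \<tau> i \<omega>)) (\<lambda>(y, t). g y (f t)) n \<omega>"
  by (simp add: Hn_def sample_mean_def)

lemma (in prob_space) tendsto_prob_union_zero:
  assumes sets: "\<And>n. A n \<in> events" "\<And>n. B n \<in> events"
    and "(\<lambda>n. prob (A n)) \<longlonglongrightarrow> 0" "(\<lambda>n. prob (B n)) \<longlonglongrightarrow> 0"
  shows "(\<lambda>n. prob (A n \<union> B n)) \<longlonglongrightarrow> 0"
proof (rule tendsto_sandwich[OF _ _ tendsto_const])
  show "(\<lambda>n. prob (A n) + prob (B n)) \<longlonglongrightarrow> 0"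
    using tendsto_add[OF assms(3,4)] by simp
  show "\<forall>\<^sub>F n in sequentially. prob (A n \<union> B n) \<le> prob (A n) + prob (B n)"
    using sets by (intro always_eventually allI measure_Un_le) auto
qed (simp add: always_eventually)

lemma (in iid_sample) sample_mean_eventually_below_growing_level:
  assumes h: "h \<in> borel_measurable borel" "\<And>z. h z \<ge> 0" "integrable P (\<lambda>\<omega>. h (Z 0 \<omega>))"
    and lam: "filterlim lam at_top sequentially" and c: "c > 0"
  shows "(\<lambda>n. prob {\<omega>\<in>space P. sample_mean Z h n \<omega> \<ge> c * lam n}) \<longlonglongrightarrow> 0"
proof (rule tendsto_sandwich[OF _ _ tendsto_const])
  let ?E = "expectation (\<lambda>\<omega>. h (Z 0 \<omega>))"
  have inf: "filterlim (\<lambda>n. c * lam n) at_top sequentially"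
    using c lam by (intro filterlim_tendsto_pos_mult_at_top[OF tendsto_const]) auto
  then show "(\<lambda>n. ?E / (c * lam n)) \<longlonglongrightarrow> 0"
    by (intro tendsto_divide_0[OF tendsto_const] filterlim_at_top_imp_at_infinity)
  have "\<forall>\<^sub>F n in sequentially. c * lam n > 0"
    using inf by (simp add: filterlim_at_top_dense)
  moreover have "\<forall>\<^sub>F n in sequentially. n \<ge> (1::nat)" by (rule eventually_ge_at_top)
  ultimately show "\<forall>\<^sub>F n in sequentially.
      prob {\<omega>\<in>space P. sample_mean Z h n \<omega> \<ge> c * lam n} \<le> ?E / (c * lam n)"
    by eventually_elim (rule sample_mean_Markov[OF h])
qed (simp add: always_eventually)

text \<open>
  Trajectories are controlled on \<open>{0..T}\<close> only.  Extending them constantly gives continuous functions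
  on the whole line, as needed for measurability, that agree with them at the observation times.
\<close>

definition clamp_time :: "real \<Rightarrow> (real \<Rightarrow> real) \<Rightarrow> real \<Rightarrow> real" where
  "clamp_time T x t = x (max 0 (min T t))"

lemma clamp_time_eq: "t \<in> {0..T} \<Longrightarrow> clamp_time T x t = x t"
  by (simp add: clamp_time_def)

lemma continuous_on_clamp_time:
  assumes "T > 0" "continuous_on {0..T} x"
  shows "continuous_on UNIV (clamp_time T x)"
  unfolding clamp_time_def[abs_def]
  by (rule continuous_on_compose2[OF assms(2)]) (use assms(1) in \<open>auto intro!: continuous_intros\<close>)

locale profiling = parametric_ivp T \<Theta> \<Gamma> F G xs zs + iid_sample P "\<lambda>i \<omega>. (Y i \<omega>, \<tau> i \<omega>)"
  for T :: real and \<Theta> :: "'p::euclidean_space set" and \<Gamma> F G xs zs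
    and P :: "'w measure" and Y \<tau> +
  fixes \<theta>0 :: "'p \<times> real \<times> real" and g :: "real \<Rightarrow> real \<Rightarrow> real"
    and L :: "nat \<Rightarrow> (real \<Rightarrow> real) set" and lam :: "nat \<Rightarrow> real"
    and xhat zhat :: "nat \<Rightarrow> 'w \<Rightarrow> 'p \<times> real \<times> real \<Rightarrow> real \<Rightarrow> real"
    and \<theta>hat :: "nat \<Rightarrow> 'w \<Rightarrow> 'p \<times> real \<times> real"
  assumes theta0: "\<theta>0 \<in> \<Theta> \<times> \<Gamma>"
    and times: "\<And>i \<omega>. \<omega> \<in> space P \<Longrightarrow> \<tau> i \<omega> \<in> {0..T}"
    and unique_max:
      "\<And>p. p \<in> \<Theta> \<times> \<Gamma> \<Longrightarrow> p \<noteq> \<theta>0 \<Longrightarrow> Mcrit P g Y \<tau> xs p < Mcrit P g Y \<tau> xs \<theta>0"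
    and g_nonneg: "\<And>y x. g y x \<ge> 0"
    and g_cont: "continuous_on UNIV (\<lambda>(y, x). g y x)"
    and growth: "\<not> (\<exists>b. AE \<omega> in P. \<bar>Y 0 \<omega>\<bar> \<le> b) \<Longrightarrow> \<forall>\<Lambda>. compact \<Lambda> \<longrightarrow> growth_cond g \<Lambda>"
    and L_subspace: "\<And>n. n \<ge> 1 \<Longrightarrow> fin_dim_C1_subspace T (L n)"
    and lam_pos: "\<And>n. n \<ge> 1 \<Longrightarrow> lam n > 0"
    and inner_max:
      "\<And>n \<omega> p. n \<ge> 1 \<Longrightarrow> \<omega> \<in> space P \<Longrightarrow> p \<in> \<Theta> \<times> \<Gamma> \<Longrightarrow>
         profile_maximizer T F G (Hn g Y \<tau> n \<omega>) (lam n) (L n) p (xhat n \<omega> p, zhat n \<omega> p)"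
    and outer_max:
      "\<And>n \<omega>. n \<ge> 1 \<Longrightarrow> \<omega> \<in> space P \<Longrightarrow>
         is_arg_max (\<lambda>p. Hn g Y \<tau> n \<omega> (xhat n \<omega> p)) (\<lambda>p. p \<in> \<Theta> \<times> \<Gamma>) (\<theta>hat n \<omega>)"
    and lam_lim: "filterlim lam at_top sequentially"
    and approx:
      "\<And>\<Theta>0 \<Gamma>0. compact \<Theta>0 \<Longrightarrow> \<Theta>0 \<subseteq> \<Theta> \<Longrightarrow> compact \<Gamma>0 \<Longrightarrow> \<Gamma>0 \<subseteq> \<Gamma> \<Longrightarrow>
         (\<lambda>n. approx_error T (L n) xs zs \<Theta>0 \<Gamma>0) \<longlonglongrightarrow> 0"
begin

abbreviation Z :: "nat \<Rightarrow> 'w \<Rightarrow> real \<times> real" where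
  "Z i \<omega> \<equiv> (Y i \<omega>, \<tau> i \<omega>)"

abbreviation curve :: "'p \<times> real \<times> real \<Rightarrow> real \<Rightarrow> real" where
  "curve p \<equiv> clamp_time T (xs p)"

lemma curve_continuous: "p \<in> \<Theta> \<times> \<Gamma> \<Longrightarrow> continuous_on UNIV (curve p)"
  by (intro continuous_on_clamp_time T_pos continuous_on_solution)

lemma curve_bounded:
  assumes "p \<in> \<Theta> \<times> \<Gamma>"
  shows "\<exists>R. \<forall>t. \<bar>curve p t\<bar> \<le> R"
proof -
  have "compact (xs p ` {0..T})"
    using assms by (intro compact_continuous_image continuous_on_solution) auto
  then obtain R where "\<forall>x\<in>xs p ` {0..T}. norm x \<le> R"
    using compact_imp_bounded bounded_iff by metis
  then show ?thesis
    using T_pos by (intro exI[of _ R]) (auto simp: clamp_time_def)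
qed

lemma loss_criterion_less:
  assumes "p \<in> \<Theta> \<times> \<Gamma>" "p \<noteq> \<theta>0"
  shows "(\<integral>\<^sup>+\<omega>. ennreal (g (Y 0 \<omega>) (curve \<theta>0 (\<tau> 0 \<omega>))) \<partial>P) <
         (\<integral>\<^sup>+\<omega>. ennreal (g (Y 0 \<omega>) (curve p (\<tau> 0 \<omega>))) \<partial>P)"
proof -
  have "(\<integral>\<^sup>+\<omega>. ennreal (g (Y 0 \<omega>) (curve q (\<tau> 0 \<omega>))) \<partial>P) =
        (\<integral>\<^sup>+\<omega>. ennreal (g (Y 0 \<omega>) (xs q (\<tau> 0 \<omega>))) \<partial>P)" for q
    by (intro nn_integral_cong) (simp only: clamp_time_eq[OF times])
  then show ?thesis
    using unique_max[OF assms] by (simp add: Mcrit_def less_ennreal.rep_eq)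
qed

text \<open>
  The expected loss at \<open>\<theta>0\<close> is strictly below another value in \<open>[0,\<infinity>]\<close>, hence finite.
\<close>

lemma integrable_loss_theta0:
  assumes p: "p \<in> \<Theta> \<times> \<Gamma>" "p \<noteq> \<theta>0"
  shows "integrable P (\<lambda>\<omega>. g (Y 0 \<omega>) (curve \<theta>0 (\<tau> 0 \<omega>)))"
proof (rule integrableI_nonneg)
  have "continuous_on UNIV ((\<lambda>(y, x). g y x) \<circ> (\<lambda>z. (fst z, curve \<theta>0 (snd z))))"
    by (intro continuous_on_compose continuous_on_subset[OF g_cont] continuous_intros
        continuous_on_compose2[OF curve_continuous[OF theta0]]) auto
  then have "(\<lambda>z. g (fst z) (curve \<theta>0 (snd z))) \<in> borel_measurable borel"
    by (intro borel_measurable_continuous_onI) (simp add: comp_def)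
  from measurable_compose[OF Z_measurable[of 0] this]
  show "(\<lambda>\<omega>. g (Y 0 \<omega>) (curve \<theta>0 (\<tau> 0 \<omega>))) \<in> borel_measurable P" by simp
  show "(\<integral>\<^sup>+\<omega>. ennreal (g (Y 0 \<omega>) (curve \<theta>0 (\<tau> 0 \<omega>))) \<partial>P) < \<infinity>"
    using loss_criterion_less[OF p] by (auto intro: less_le_trans)
qed (simp add: g_nonneg)

text \<open>
  On curves bounded by \<open>R\<close>, the sample loss is at most the sample mean of \<open>S y = sup {g y x | \<bar>x\<bar> < r}\<close>
  with \<open>r > R\<close>.  This function is integrable, so by Markov's inequality its sample mean exceeds
  \<open>c * lam n\<close> only with probability of order \<open>1 / lam n\<close>.  The estimate is uniform over the fits for
  all parameters in the ball, so that it applies to the random parameter \<open>\<theta>hat n\<close>.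
\<close>

lemma profile_fit_close_with_high_probability:
  assumes p1: "p1 \<in> \<Theta> \<times> \<Gamma>" and \<eta>: "\<eta> > 0"
    and int: "integrable P (\<lambda>\<omega>. g (Y 0 \<omega>) (curve \<theta>0 (\<tau> 0 \<omega>)))"
  shows "\<exists>\<rho>>0. \<exists>A. (\<forall>n. A n \<in> events) \<and> (\<lambda>n. prob (A n)) \<longlonglongrightarrow> 0 \<and>
    (\<forall>\<^sub>F n in sequentially. \<forall>\<omega>\<in>space P - A n. \<forall>p\<in>(\<Theta> \<times> \<Gamma>) \<inter> ball p1 \<rho>. \<forall>t\<in>{0..T}.
       \<bar>xhat n \<omega> p t - xs p1 t\<bar> < \<eta>)"
proof -
  have "\<exists>\<rho>>0. \<exists>c>0. \<exists>R. \<forall>\<^sub>F n in sequentially. \<forall>H. \<forall>p\<in>(\<Theta> \<times> \<Gamma>) \<inter> ball p1 \<rho>. \<forall>x z.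
       (\<forall>w. H w \<le> 0) \<longrightarrow> (\<forall>w. (\<forall>t\<in>{0..T}. \<bar>w t\<bar> \<le> R) \<longrightarrow> - H w \<le> c * lam n) \<longrightarrow>
       profile_maximizer T F G H (lam n) (L n) p (x, z) \<longrightarrow>
       (\<forall>t\<in>{0..T}. \<bar>x t - xs p1 t\<bar> \<le> \<eta> / 2)"
    by (rule profile_fit_near_trajectory[of L lam p1 "\<eta> / 2"])
       (use L_subspace lam_pos approx p1 \<eta> in auto)
  then obtain \<rho> c R where \<rho>: "\<rho> > 0" and c: "c > 0"
    and fit: "\<forall>\<^sub>F n in sequentially. \<forall>H. \<forall>p\<in>(\<Theta> \<times> \<Gamma>) \<inter> ball p1 \<rho>. \<forall>x z.
       (\<forall>w. H w \<le> 0) \<longrightarrow> (\<forall>w. (\<forall>t\<in>{0..T}. \<bar>w t\<bar> \<le> R) \<longrightarrow> - H w \<le> c * lam n) \<longrightarrow>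
       profile_maximizer T F G H (lam n) (L n) p (x, z) \<longrightarrow>
       (\<forall>t\<in>{0..T}. \<bar>x t - xs p1 t\<bar> \<le> \<eta> / 2)"
    by blast
  define r where "r = max R 0 + 1"
  define S where "S = upper_env g r (\<lambda>_. 0)"
  have r: "r > 0" "R < r" by (auto simp: r_def)
  obtain R0 where R0: "\<And>t. \<bar>curve \<theta>0 t\<bar> \<le> R0" using curve_bounded[OF theta0] by blast
  have Sm: "S \<in> borel_measurable borel"
    unfolding S_def by (intro envelope_measurable g_cont continuous_intros)
  have S_ge: "g y x \<le> S (y, t)" if "\<bar>x\<bar> < r" for y x t
    unfolding S_def using that by (intro envelope_bounds(2)[OF g_cont]) simp
  have S0: "0 \<le> S z" for z
    using S_ge[of 0 "fst z" "snd z"] g_nonneg[of "fst z" 0] r(1) by simp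
  have Si: "integrable P (\<lambda>\<omega>. S (Z 0 \<omega>))"
    unfolding S_def
    by (rule integrable_upper_env[OF g_cont g_nonneg, of _ 0 "curve \<theta>0" R0])
       (use growth int R0 r(1) in \<open>auto intro: continuous_intros\<close>)
  define A where "A n = {\<omega>\<in>space P. sample_mean Z S n \<omega> \<ge> c * lam n}" for n
  show ?thesis
  proof (intro exI[of _ \<rho>] conjI exI[of _ A] allI \<rho>)
    show "A n \<in> events" for n
      using sample_mean_measurable[OF Sm, of n] unfolding A_def by measurable
    show "(\<lambda>n. prob (A n)) \<longlonglongrightarrow> 0"
      unfolding A_def by (rule sample_mean_eventually_below_growing_level[OF Sm S0 Si lam_lim c])
    have "\<forall>\<^sub>F n in sequentially. n \<ge> (1::nat)" by (rule eventually_ge_at_top)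
    with fit show "\<forall>\<^sub>F n in sequentially. \<forall>\<omega>\<in>space P - A n. \<forall>p\<in>(\<Theta> \<times> \<Gamma>) \<inter> ball p1 \<rho>.
        \<forall>t\<in>{0..T}. \<bar>xhat n \<omega> p t - xs p1 t\<bar> < \<eta>"
    proof eventually_elim
      case (elim n)
      show ?case
      proof (intro ballI)
        fix \<omega> p t
        assume \<omega>: "\<omega> \<in> space P - A n" and p: "p \<in> (\<Theta> \<times> \<Gamma>) \<inter> ball p1 \<rho>" and t: "t \<in> {0..T}"
        let ?H = "Hn g Y \<tau> n \<omega>"
        have H0: "?H w \<le> 0" for w
          unfolding Hn_eq_sample_mean sample_mean_def
          by (simp add: g_nonneg sum_nonneg)
        have HR: "- ?H w \<le> c * lam n" if w: "\<forall>t\<in>{0..T}. \<bar>w t\<bar> \<le> R" for w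
        proof -
          have "- ?H w \<le> sample_mean Z S n \<omega>"
            unfolding Hn_eq_sample_mean minus_minus
          proof (rule sample_mean_mono)
            fix i
            have "\<bar>w (\<tau> i \<omega>)\<bar> < r" using w times[of \<omega> i] \<omega> r(2) by fastforce
            then show "(case Z i \<omega> of (y, t) \<Rightarrow> g y (w t)) \<le> S (Z i \<omega>)" using S_ge by simp
          qed
          also have "\<dots> \<le> c * lam n" using \<omega> by (auto simp: A_def)
          finally show ?thesis .
        qed
        have "profile_maximizer T F G ?H (lam n) (L n) p (xhat n \<omega> p, zhat n \<omega> p)"
          using \<omega> p elim(2) by (intro inner_max) auto
        then have "\<bar>xhat n \<omega> p t - xs p1 t\<bar> \<le> \<eta> / 2"
          using elim(1) p H0 HR t by blast
        then show "\<bar>xhat n \<omega> p t - xs p1 t\<bar> < \<eta>" using \<eta> by linarith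
      qed
    qed
  qed
qed

text \<open>
  Choose \<open>c\<close> strictly between the expected losses at \<open>\<theta>0\<close> and at \<open>p1\<close>.  For small tubes, the upper
  envelope around the true trajectory still has expectation below \<open>c\<close>, and the truncated lower
  envelope around the trajectory of \<open>p1\<close> has expectation above \<open>c\<close>.  With probability tending to 1
  the sample means are on the same sides of \<open>c\<close> and the fits for \<open>\<theta>0\<close> and for all parameters near \<open>p1\<close>
  lie in the tubes; then no parameter near \<open>p1\<close> can attain the sample loss of the fit at \<open>\<theta>0\<close>.
\<close>

lemma wrong_parameter_locally_excluded:
  assumes p1: "p1 \<in> \<Theta> \<times> \<Gamma>" "p1 \<noteq> \<theta>0"
  shows "\<exists>N. open N \<and> p1 \<in> N \<and> (\<lambda>n. prob {\<omega>\<in>space P. \<theta>hat n \<omega> \<in> N}) \<longlonglongrightarrow> 0"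
proof -
  note int = integrable_loss_theta0[OF p1]
  have lt: "ennreal (expectation (\<lambda>\<omega>. g (Y 0 \<omega>) (curve \<theta>0 (\<tau> 0 \<omega>)))) <
      (\<integral>\<^sup>+\<omega>. ennreal (g (Y 0 \<omega>) (curve p1 (\<tau> 0 \<omega>))) \<partial>P)"
    using loss_criterion_less[OF p1] nn_integral_eq_integral[OF int] g_nonneg by simp
  then obtain e where e: "ennreal (expectation (\<lambda>\<omega>. g (Y 0 \<omega>) (curve \<theta>0 (\<tau> 0 \<omega>)))) < e"
    "e < (\<integral>\<^sup>+\<omega>. ennreal (g (Y 0 \<omega>) (curve p1 (\<tau> 0 \<omega>))) \<partial>P)"
    using dense by blast
  then obtain c where c: "e = ennreal c" "c \<ge> 0" by (cases e) auto
  have c_gt: "expectation (\<lambda>\<omega>. g (Y 0 \<omega>) (curve \<theta>0 (\<tau> 0 \<omega>))) < c"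
    using e(1) c ennreal_leI[of c] by (meson not_less)
  obtain R0 where R0: "\<And>t. \<bar>curve \<theta>0 t\<bar> \<le> R0" using curve_bounded[OF theta0] by blast
  have upper_int: "integrable P (\<lambda>\<omega>. upper_env g \<eta> (curve \<theta>0) (Z 0 \<omega>))" if "\<eta> > 0" for \<eta>
    by (rule integrable_upper_env[OF g_cont g_nonneg, of _ R0 "curve \<theta>0" R0])
       (use growth int R0 that curve_continuous[OF theta0] in auto)
  obtain \<eta>1 m where \<eta>1: "\<eta>1 > 0" "m \<ge> 0"
    and lower: "c < expectation (\<lambda>\<omega>. min m (lower_env g \<eta>1 (curve p1) (Z 0 \<omega>)))"
    using lower_env_expectation_gt[OF g_cont g_nonneg curve_continuous[OF p1(1)], of c] e(2) c by auto
  obtain \<eta>0 where \<eta>0: "\<eta>0 > 0"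
    and upper: "expectation (\<lambda>\<omega>. upper_env g \<eta>0 (curve \<theta>0) (Z 0 \<omega>)) < c"
    using upper_env_expectation_less[OF g_cont g_nonneg curve_continuous[OF theta0] upper_int, of c] c_gt
    by auto
  define \<phi> where "\<phi> z = min m (lower_env g \<eta>1 (curve p1) z)" for z
  define \<psi> where "\<psi> = upper_env g \<eta>0 (curve \<theta>0)"
  have \<phi>m: "\<phi> \<in> borel_measurable borel"
    using envelope_measurable(1)[OF g_cont curve_continuous[OF p1(1)], of \<eta>1]
    unfolding \<phi>_def[abs_def] by measurable
  have \<psi>m: "\<psi> \<in> borel_measurable borel"
    unfolding \<psi>_def by (rule envelope_measurable(2)[OF g_cont curve_continuous[OF theta0]])
  have \<phi>_bd: "0 \<le> \<phi> z" "\<phi> z \<le> m" for z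
  proof -
    have "0 \<le> lower_env g \<eta>1 (curve p1) z"
      by (rule lower_env_nonneg[OF g_nonneg \<eta>1(1)])
    then show "0 \<le> \<phi> z" "\<phi> z \<le> m" using \<eta>1(2) by (auto simp: \<phi>_def)
  qed
  have \<psi>_bd: "0 \<le> \<psi> z" for z
    using envelope_bounds(2)[OF g_cont, of "curve \<theta>0 (snd z)" "curve \<theta>0" "snd z" \<eta>0 "fst z"]
      g_nonneg[of "fst z" "curve \<theta>0 (snd z)"] \<eta>0 by (simp add: \<psi>_def)
  define B1 where "B1 n = {\<omega>\<in>space P. sample_mean Z \<phi> n \<omega> \<le> c}" for n
  define B2 where "B2 n = {\<omega>\<in>space P. sample_mean Z \<psi> n \<omega> \<ge> c}" for n
  have B1: "B1 n \<in> events" "(\<lambda>n. prob (B1 n)) \<longlonglongrightarrow> 0" for n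
  proof -
    show "B1 n \<in> events" using sample_mean_measurable[OF \<phi>m, of n] unfolding B1_def by measurable
    have "expectation (\<lambda>\<omega>. \<phi> (Z 0 \<omega>)) - c > 0" using lower by (simp add: \<phi>_def)
    from sample_mean_bounded_tails(2)[OF \<phi>m \<phi>_bd this]
    show "(\<lambda>n. prob (B1 n)) \<longlonglongrightarrow> 0" by (simp add: B1_def)
  qed
  have B2: "B2 n \<in> events" "(\<lambda>n. prob (B2 n)) \<longlonglongrightarrow> 0" for n
  proof -
    show "B2 n \<in> events" using sample_mean_measurable[OF \<psi>m, of n] unfolding B2_def by measurable
    show "(\<lambda>n. prob (B2 n)) \<longlonglongrightarrow> 0"
      unfolding B2_def
      using upper_int[OF \<eta>0] upper by (intro sample_mean_upper_tail \<psi>m \<psi>_bd) (auto simp: \<psi>_def)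
  qed
  obtain \<rho>1 A1 where \<rho>1: "\<rho>1 > 0" and A1: "\<And>n. A1 n \<in> events" "(\<lambda>n. prob (A1 n)) \<longlonglongrightarrow> 0"
    and fit1: "\<forall>\<^sub>F n in sequentially. \<forall>\<omega>\<in>space P - A1 n. \<forall>p\<in>(\<Theta> \<times> \<Gamma>) \<inter> ball p1 \<rho>1. \<forall>t\<in>{0..T}.
       \<bar>xhat n \<omega> p t - xs p1 t\<bar> < \<eta>1"
    using profile_fit_close_with_high_probability[OF p1(1) \<eta>1(1) int] by blast
  obtain \<rho>0 A0 where \<rho>0: "\<rho>0 > 0" and A0: "\<And>n. A0 n \<in> events" "(\<lambda>n. prob (A0 n)) \<longlonglongrightarrow> 0"
    and fit0: "\<forall>\<^sub>F n in sequentially. \<forall>\<omega>\<in>space P - A0 n. \<forall>p\<in>(\<Theta> \<times> \<Gamma>) \<inter> ball \<theta>0 \<rho>0. \<forall>t\<in>{0..T}.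
       \<bar>xhat n \<omega> p t - xs \<theta>0 t\<bar> < \<eta>0"
    using profile_fit_close_with_high_probability[OF theta0 \<eta>0 int] by blast
  \<comment> \<open>The fits may leave their tubes, or a sample mean may fall on the wrong side of \<open>c\<close>.\<close>
  define bad where "bad n = (A1 n \<union> A0 n) \<union> (B1 n \<union> B2 n)" for n
  have bad: "bad n \<in> events" "(\<lambda>n. prob (bad n)) \<longlonglongrightarrow> 0" for n
    unfolding bad_def using A1 A0 B1 B2
    by (auto intro!: tendsto_prob_union_zero)
  have "\<forall>\<^sub>F n in sequentially. n \<ge> (1::nat)" by (rule eventually_ge_at_top)
  with fit1 fit0 have incl: "\<forall>\<^sub>F n in sequentially. {\<omega>\<in>space P. \<theta>hat n \<omega> \<in> ball p1 \<rho>1} \<subseteq> bad n"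
  proof eventually_elim
    case (elim n)
    show ?case
    proof (rule subsetI, rule ccontr)
      fix \<omega> assume "\<omega> \<in> {\<omega>\<in>space P. \<theta>hat n \<omega> \<in> ball p1 \<rho>1}" and nb: "\<omega> \<notin> bad n"
      then have \<omega>: "\<omega> \<in> space P" and N: "\<theta>hat n \<omega> \<in> ball p1 \<rho>1" by auto
      let ?H = "Hn g Y \<tau> n \<omega>"
      have opt: "\<theta>hat n \<omega> \<in> \<Theta> \<times> \<Gamma>" "?H (xhat n \<omega> \<theta>0) \<le> ?H (xhat n \<omega> (\<theta>hat n \<omega>))"
        using outer_max[OF elim(3) \<omega>] theta0 unfolding is_arg_max_linorder by auto
      have "c < sample_mean Z \<phi> n \<omega>" using nb \<omega> by (auto simp: bad_def B1_def)
      also have "\<dots> \<le> - ?H (xhat n \<omega> (\<theta>hat n \<omega>))"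
        unfolding Hn_eq_sample_mean minus_minus
      proof (rule sample_mean_mono)
        fix i
        have "\<bar>xhat n \<omega> (\<theta>hat n \<omega>) (\<tau> i \<omega>) - xs p1 (\<tau> i \<omega>)\<bar> < \<eta>1"
        proof -
          have "\<omega> \<in> space P - A1 n" using nb \<omega> by (simp add: bad_def)
          from bspec[OF bspec[OF bspec[OF elim(1) this] IntI[OF opt(1) N]] times[OF \<omega>]] show ?thesis .
        qed
        then have "lower_env g \<eta>1 (curve p1) (Z i \<omega>) \<le> g (Y i \<omega>) (xhat n \<omega> (\<theta>hat n \<omega>) (\<tau> i \<omega>))"
          by (intro envelope_bounds(1)[OF g_cont]) (simp only: clamp_time_eq[OF times[OF \<omega>]])
        then show "\<phi> (Z i \<omega>) \<le> (case Z i \<omega> of (y, t) \<Rightarrow> g y (xhat n \<omega> (\<theta>hat n \<omega>) t))"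
          by (simp add: \<phi>_def min.coboundedI2)
      qed
      also have "\<dots> \<le> - ?H (xhat n \<omega> \<theta>0)" using opt(2) by simp
      also have "\<dots> \<le> sample_mean Z \<psi> n \<omega>"
        unfolding Hn_eq_sample_mean minus_minus
      proof (rule sample_mean_mono)
        fix i
        have "\<bar>xhat n \<omega> \<theta>0 (\<tau> i \<omega>) - xs \<theta>0 (\<tau> i \<omega>)\<bar> < \<eta>0"
        proof -
          have "\<omega> \<in> space P - A0 n" using nb \<omega> by (simp add: bad_def)
          moreover have "\<theta>0 \<in> (\<Theta> \<times> \<Gamma>) \<inter> ball \<theta>0 \<rho>0" using theta0 \<rho>0 by simp
          ultimately show ?thesis using elim(2) times[OF \<omega>] by blast
        qed
        then have "g (Y i \<omega>) (xhat n \<omega> \<theta>0 (\<tau> i \<omega>)) \<le> upper_env g \<eta>0 (curve \<theta>0) (Z i \<omega>)"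
          by (intro envelope_bounds(2)[OF g_cont]) (simp only: clamp_time_eq[OF times[OF \<omega>]])
        then show "(case Z i \<omega> of (y, t) \<Rightarrow> g y (xhat n \<omega> \<theta>0 t)) \<le> \<psi> (Z i \<omega>)"
          by (simp add: \<psi>_def)
      qed
      finally show False using nb \<omega> by (auto simp: bad_def B2_def)
    qed
  qed
  show ?thesis
  proof (intro exI[of _ "ball p1 \<rho>1"] conjI)
    show "p1 \<in> ball p1 \<rho>1" using \<rho>1 by simp
    show "(\<lambda>n. prob {\<omega>\<in>space P. \<theta>hat n \<omega> \<in> ball p1 \<rho>1}) \<longlonglongrightarrow> 0"
    proof (rule tendsto_sandwich[OF _ _ tendsto_const bad(2)])
      show "\<forall>\<^sub>F n in sequentially. prob {\<omega>\<in>space P. \<theta>hat n \<omega> \<in> ball p1 \<rho>1} \<le> prob (bad n)"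
        using incl by eventually_elim (intro finite_measure_mono bad(1))
    qed (simp add: always_eventually)
  qed simp
qed

end

section \<open>Consistency of the estimator\<close>

theorem theorem3p2:
  fixes T :: real
    and \<Theta> :: "(real ^ 'd) set"
    and \<Gamma> :: "(real \<times> real) set"
    and F G :: "real \<Rightarrow> real \<Rightarrow> real \<Rightarrow> real ^ 'd \<Rightarrow> real"
    and xs zs :: "(real ^ 'd) \<times> real \<times> real \<Rightarrow> real \<Rightarrow> real"
    and P :: "'w measure"
    and Y \<tau> :: "nat \<Rightarrow> 'w \<Rightarrow> real"
    and \<theta>0 :: "(real ^ 'd) \<times> real \<times> real"
    and g :: "real \<Rightarrow> real \<Rightarrow> real"
    and L :: "nat \<Rightarrow> (real \<Rightarrow> real) set"
    and lam :: "nat \<Rightarrow> real"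
    and xhat zhat :: "nat \<Rightarrow> 'w \<Rightarrow> (real ^ 'd) \<times> real \<times> real \<Rightarrow> real \<Rightarrow> real"
    and \<theta>hat :: "nat \<Rightarrow> 'w \<Rightarrow> (real ^ 'd) \<times> real \<times> real"
  assumes T_pos: "T > 0"
    and Theta: "open \<Theta>" "convex \<Theta>"
    and Gamma: "open \<Gamma>" "convex \<Gamma>"
    and theta0: "\<theta>0 \<in> \<Theta> \<times> \<Gamma>"
    and prob: "prob_space P"
    and data_iid: "iid P (\<lambda>i \<omega>. (Y i \<omega>, \<tau> i \<omega>))"
    and times: "\<And>i \<omega>. \<omega> \<in> space P \<Longrightarrow> \<tau> i \<omega> \<in> {0..T}"
    and A1: "\<exists>f c C. 0 < c \<and> 0 < C \<and> (\<forall>t\<in>{0..T}. c \<le> f t \<and> f t \<le> C) \<and>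
               distributed P lborel (\<tau> 0) (\<lambda>t. ennreal (f t) * indicator {0..T} t)"
    and A2_smooth:
      "Ck_on 3 (UNIV \<times> UNIV \<times> {0..T} \<times> \<Theta>) (\<lambda>(x, z, t, \<theta>). F x z t \<theta>)"
      "Ck_on 3 (UNIV \<times> UNIV \<times> {0..T} \<times> \<Theta>) (\<lambda>(x, z, t, \<theta>). G x z t \<theta>)"
    and A2_solution:
      "\<And>\<theta>s. \<theta>s \<in> \<Theta> \<times> \<Gamma> \<Longrightarrow> ivp_solution T F G \<theta>s (xs \<theta>s) (zs \<theta>s)"
    and A2_unique:
      "\<And>\<theta>s x z. \<theta>s \<in> \<Theta> \<times> \<Gamma> \<Longrightarrow> ivp_solution T F G \<theta>s x z \<Longrightarrow>
         \<forall>t\<in>{0..T}. x t = xs \<theta>s t \<and> z t = zs \<theta>s t"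
    and A2_identifiable:
      "\<And>\<theta>s \<theta>s'. \<theta>s \<in> \<Theta> \<times> \<Gamma> \<Longrightarrow> \<theta>s' \<in> \<Theta> \<times> \<Gamma> \<Longrightarrow> \<theta>s \<noteq> \<theta>s' \<Longrightarrow>
         \<exists>t\<in>{0..T}. xs \<theta>s t \<noteq> xs \<theta>s' t"
    and A3_continuous: "continuous_on (\<Theta> \<times> \<Gamma>) (Mcrit P g Y \<tau> xs)"
    and A3_unique_max:
      "\<And>\<theta>s. \<theta>s \<in> \<Theta> \<times> \<Gamma> \<Longrightarrow> \<theta>s \<noteq> \<theta>0 \<Longrightarrow> Mcrit P g Y \<tau> xs \<theta>s < Mcrit P g Y \<tau> xs \<theta>0"
    and A5_nonneg: "\<And>y x. g y x \<ge> 0"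
    and A5_C1: "Ck_on 1 UNIV (\<lambda>(y, x). g y x)"
    and A5_moment: "(\<integral>\<^sup>+\<omega>. ennreal \<bar>deriv (g (Y 0 \<omega>)) (xs \<theta>0 (\<tau> 0 \<omega>))\<bar> \<partial>P) < \<infinity>"
    and A5_growth:
      "\<not> (\<exists>b. AE \<omega> in P. \<bar>Y 0 \<omega>\<bar> \<le> b) \<Longrightarrow>
         \<forall>\<Lambda>. compact \<Lambda> \<longrightarrow> growth_cond g \<Lambda> \<and> growth_cond (\<lambda>y. deriv (g y)) \<Lambda>"
    and L_subspace: "\<And>n. n \<ge> 1 \<Longrightarrow> fin_dim_C1_subspace T (L n)"
    and lam_pos: "\<And>n. n \<ge> 1 \<Longrightarrow> lam n > 0"
    and inner_max:
      "\<And>n \<omega> \<theta>s. n \<ge> 1 \<Longrightarrow> \<omega> \<in> space P \<Longrightarrow> \<theta>s \<in> \<Theta> \<times> \<Gamma> \<Longrightarrow>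
         profile_maximizer T F G (Hn g Y \<tau> n \<omega>) (lam n) (L n) \<theta>s (xhat n \<omega> \<theta>s, zhat n \<omega> \<theta>s)"
    and estimator_measurable: "\<And>n. n \<ge> 1 \<Longrightarrow> \<theta>hat n \<in> borel_measurable P"
    and outer_max:
      "\<And>n \<omega>. n \<ge> 1 \<Longrightarrow> \<omega> \<in> space P \<Longrightarrow>
         is_arg_max (\<lambda>\<theta>s. Hn g Y \<tau> n \<omega> (xhat n \<omega> \<theta>s)) (\<lambda>\<theta>s. \<theta>s \<in> \<Theta> \<times> \<Gamma>) (\<theta>hat n \<omega>)"
    and tight: "uniformly_tight P (\<Theta> \<times> \<Gamma>) \<theta>hat"
    and lam_lim: "filterlim lam at_top sequentially"
    and approx:
      "\<And>\<Theta>0 \<Gamma>0. compact \<Theta>0 \<Longrightarrow> \<Theta>0 \<subseteq> \<Theta> \<Longrightarrow> compact \<Gamma>0 \<Longrightarrow> \<Gamma>0 \<subseteq> \<Gamma> \<Longrightarrow>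
         (\<lambda>n. approx_error T (L n) xs zs \<Theta>0 \<Gamma>0) \<longlonglongrightarrow> 0"
  shows "tendsto_in_prob P \<theta>hat \<theta>0"
proof -
  have smooth: "Ck_on 1 (UNIV \<times> UNIV \<times> {0..T} \<times> \<Theta>) (\<lambda>(x, z, t, \<theta>). F x z t \<theta>)"
    "Ck_on 1 (UNIV \<times> UNIV \<times> {0..T} \<times> \<Theta>) (\<lambda>(x, z, t, \<theta>). G x z t \<theta>)"
    by (rule A2_smooth[unfolded numeral_3_eq_3, THEN Ck_on_Suc_imp_Ck_on_1])+
  interpret prob_space P by (rule prob)
  interpret profiling T \<Theta> \<Gamma> F G xs zs P Y \<tau> \<theta>0 g L lam xhat zhat \<theta>hat
  proof
    show "continuous_on UNIV (\<lambda>(y, x). g y x)" by (rule Ck_on_imp_continuous_on[OF A5_C1])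
    show "\<forall>\<Lambda>. compact \<Lambda> \<longrightarrow> growth_cond g \<Lambda>" if "\<not> (\<exists>b. AE \<omega> in P. \<bar>Y 0 \<omega>\<bar> \<le> b)"
      using A5_growth[OF that] by blast
  qed (fact T_pos Theta(1) Gamma(1) smooth
      A2_solution data_iid theta0 times A3_unique_max A5_nonneg L_subspace lam_pos inner_max
      outer_max lam_lim approx)+
  show ?thesis
    using tendsto_in_prob_if_locally_excluded[OF estimator_measurable tight
        wrong_parameter_locally_excluded] .
qed

end
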